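(* Let $\{X_i\}_{i\ge 1}$ be a stationary Markov chain on $(\mathcal X,\mathcal B)$ with invariant distribution $\pi$ (so $X_1\sim\pi$) and absolute spectral gap $1-\lambda>0$, where $\lambda=\lambda(P)\in[0,1)$. Let $n\ge 1$, $c>0$, and let $f_1,\dots,f_n:\mathcal X\to\mathbb R$ be measurable functions with $|f_i|\le c$ and $\pi(f_i)=0$ for all $i$. Put $\sigma^2=\frac1n\sum_{i=1}^n\pi(f_i^2)$. Then for any $0\le t<(1-\lambda)/(5c)$, $$\mathbb E_\pi\left[e^{t\sum_{i=1}^n f_i(X_i)}\right]\le e^{n g(t;\lambda,c,\sigma^2)},\qquad g(t;\lambda,c,\sigma^2)=\frac{\sigma^2}{c^2}\left(e^{tc}-1-tc\right)+\frac{\sigma^2\lambda t^2}{1-\lambda-5ct}.$$ Moreover, for any $\epsilon>0$, $$\mathbb P_\pi\left(\frac1n\sum_{i=1}^n f_i(X_i)\ge\epsilon\right)\le e^{-n g^*(\epsilon;\lambda,c,\sigma^2)},$$ where $g^*(\,\cdot\,;\lambda,c,\sigma^2)$ is the convex conjugate of $g(\,\cdot\,;\lambda,c,\sigma^2)$ (as specified in the context), and $$g^*(\epsilon;\lambda,c,\sigma^2)\ge\frac{\epsilon^2/2}{\alpha_1(\lambda)\,\sigma^2+\alpha_2(\lambda)\,c\,\epsilon},\qquad \alpha_1(\lambda)=\frac{1+\lambda}{1-\lambda},\qquad \alpha_2(\lambda)=\begin{cases}1/3 & \text{if }\lambda=0,\\ 5/(1-\lambda) & \text{if }\lambda\in(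0,1).\end{cases}$$
   Context: $(\mathcal X,\mathcal B)$ is a standard Borel space and the Markov chain is time-homogeneous (not necessarily reversible) with transition kernel $P(x,B)$ that leaves the probability measure $\pi$ invariant. For measurable $h:\mathcal X\to\mathbb R$ write $\pi(h)=\int h\,d\pi$. $\mathcal L_2=\{h:\pi(h^2)<\infty\}$ is the real Hilbert space with inner product $\langle h_1,h_2\rangle_\pi=\pi(h_1h_2)$ and norm $\|h\|_\pi$, and $\mathcal L_2^0=\{h\in\mathcal L_2:\pi(h)=0\}$. The kernel acts on $\mathcal L_2$ by $Ph(x)=\int h(y)P(x,dy)$. The chain has absolute spectral gap $1-\lambda(P)>0$ if $$\lambda(P)=\sup\{\|Ph\|_\pi:\|h\|_\pi=1,\ h\in\mathcal L_2^0\}<1;$$ equivalently, $\lambda(P)$ is the operator norm on $\mathcal L_2$ of $P-\mathit\Pi$, where $\mathit\Pi h=\pi(h)\mathit 1$ and $\mathit 1$ is the constant function one. $\mathbb E_\pi,\mathbb P_\pi$ denote expectation and probability for the chain started from $X_1\sim\pi$. Convex conjugate: for $\lambda\in(0,1)$, $g^*(\epsilon;\lambda,c,\sigma^2)=\sup\{t\epsilon-g(t;\lambda,c,\sigma^2):0\le t<(1-\lambda)/(5c)\}$. For $\lambda=0$ the second summand of $g$ is identically $0$, so $g(t;0,c,\sigma^2)=\frac{\sigma^2}{c^2}(e^{tc}-1-tc)$, and $g^*(\epsilon;0,c,\sigma^2)=\sup\{t\epsilon-g(t;0,c,\sigma^2):t\ge0\}$. *)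

theory Defs
  imports "HOL-Probability.Probability"
begin

definition standard_borel :: "'a measure \<Rightarrow> bool" where
  "standard_borel M \<longleftrightarrow>
     (\<exists>T. completely_metrizable_space T \<and> second_countable T \<and>
          topspace T = space M \<and> sets M = sigma_sets (topspace T) {U. openin T U})"

definition markov_kernel :: "'a measure \<Rightarrow> ('a \<Rightarrow> 'a measure) \<Rightarrow> bool" where
  "markov_kernel M P \<longleftrightarrow> P \<in> M \<rightarrow>\<^sub>M prob_algebra M"

definition invariant_distribution :: "'a measure \<Rightarrow> ('a \<Rightarrow> 'a measure) \<Rightarrow> 'a measure \<Rightarrow> bool" where
  "invariant_distribution M P \<pi> \<longleftrightarrow> prob_space \<pi> \<and> sets \<pi> = sets M \<and> \<pi> \<bind> P = \<pi>"

definition past :: "'w measure \<Rightarrow> 'a measure \<Rightarrow> (nat \<Rightarrow> 'w \<Rightarrow> 'a) \<Rightarrow> nat \<Rightarrow> 'w measure" where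
  "past \<Omega> M X i = sigma (space \<Omega>) {X j -` B \<inter> space \<Omega> | j B. j \<in> {1..i} \<and> B \<in> sets M}"

(* The chain is indexed by i >= 1; X 0 is unconstrained. *)
definition stationary_markov_chain ::
  "'w measure \<Rightarrow> 'a measure \<Rightarrow> ('a \<Rightarrow> 'a measure) \<Rightarrow> 'a measure \<Rightarrow> (nat \<Rightarrow> 'w \<Rightarrow> 'a) \<Rightarrow> bool" where
  "stationary_markov_chain \<Omega> M P \<pi> X \<longleftrightarrow>
     prob_space \<Omega> \<and> markov_kernel M P \<and> invariant_distribution M P \<pi> \<and>
     (\<forall>i\<ge>1. X i \<in> \<Omega> \<rightarrow>\<^sub>M M) \<and>
     distr \<Omega> M (X 1) = \<pi> \<and>
     (\<forall>i\<ge>1. \<forall>B\<in>sets M. AE \<omega> in \<Omega>.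
        real_cond_exp \<Omega> (past \<Omega> M X i) (indicator (X (Suc i) -` B \<inter> space \<Omega>)) \<omega>
          = measure (P (X i \<omega>)) B)"

definition L2 :: "'a measure \<Rightarrow> ('a \<Rightarrow> real) set" where
  "L2 \<pi> = {h \<in> borel_measurable \<pi>. integrable \<pi> (\<lambda>x. (h x)\<^sup>2)}"

definition L2_0 :: "'a measure \<Rightarrow> ('a \<Rightarrow> real) set" where
  "L2_0 \<pi> = {h \<in> L2 \<pi>. (\<integral>x. h x \<partial>\<pi>) = 0}"

definition L2_norm :: "'a measure \<Rightarrow> ('a \<Rightarrow> real) \<Rightarrow> real" where
  "L2_norm \<pi> h = sqrt (\<integral>x. (h x)\<^sup>2 \<partial>\<pi>)"

definition kernel_apply :: "('a \<Rightarrow> 'a measure) \<Rightarrow> ('a \<Rightarrow> real) \<Rightarrow> 'a \<Rightarrow> real" where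
  "kernel_apply P h x = (\<integral>y. h y \<partial>P x)"

(* Inserting 0 only matters when L2_0 contains no function of norm 1: the supremum over the
   empty set is then 0, which is the operator norm of P - Pi in that case. *)
definition kernel_lambda :: "'a measure \<Rightarrow> ('a \<Rightarrow> 'a measure) \<Rightarrow> real" where
  "kernel_lambda \<pi> P =
     Sup (insert 0 {L2_norm \<pi> (kernel_apply P h) | h. h \<in> L2_0 \<pi> \<and> L2_norm \<pi> h = 1})"

(* In g and gstar the argument s stands for \<sigma>^2. For lam = 0 the second
   summand of g vanishes for every t, since 0 / x = 0 also when x = 0. *)
definition g :: "real \<Rightarrow> real \<Rightarrow> real \<Rightarrow> real \<Rightarrow> real" where
  "g t lam c s = s / c\<^sup>2 * (exp (t * c) - 1 - t * c) + s * lam * t\<^sup>2 / (1 - lam - 5 * c * t)"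

(* Extended-real valued: for lam = 0 and s = 0 the supremum is infinite. *)
definition gstar :: "real \<Rightarrow> real \<Rightarrow> real \<Rightarrow> real \<Rightarrow> ereal" where
  "gstar \<epsilon> lam c s =
     (SUP t \<in> (if lam = 0 then {0..} else {0..<(1 - lam) / (5 * c)}). ereal (t * \<epsilon> - g t lam c s))"

definition exp_ereal :: "ereal \<Rightarrow> ereal" where
  "exp_ereal x = (case x of ereal r \<Rightarrow> ereal (exp r) | PInfty \<Rightarrow> \<infinity> | MInfty \<Rightarrow> 0)"

definition \<alpha>1 :: "real \<Rightarrow> real" where
  "\<alpha>1 lam = (1 + lam) / (1 - lam)"

definition \<alpha>2 :: "real \<Rightarrow> real" where
  "\<alpha>2 lam = (if lam = 0 then 1 / 3 else 5 / (1 - lam))"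

end

(*
  Let a = exp (t f / 2) with f bounded by c, centred and of variance s. The spectral gap gives
  |<u, P v>|^2 <= Q u * Q v, where Q h = lam ||h||^2 + (1 - lam) (pi h)^2 is the quadratic form of
  the Leon-Perron operator lam I + (1 - lam) Pi. The weighted Cauchy-Schwarz inequality
  (pi (a h))^2 <= pi ((r - lam a^2) h^2) * pi (a^2 / (r - lam a^2)) yields Q (a h) <= r ||h||^2 as soon as
  (1 - lam) pi (e^(t f) / (r - lam e^(t f))) <= 1, and expanding e^u / (r - lam e^u) at u = 0 shows that
  r = exp (g t lam c s) is large enough. Hence every factor exp (t f_i (X_i)) costs at most
  exp (g t lam c s_i), and g is linear in s. The tail bound is Chernoff's, and the choice
  t = eps / (alpha1 s + alpha2 c eps) bounds the conjugate from below.
*)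
theory Submission
  imports Defs
begin

section \<open>Exponential inequalities\<close>

text \<open>The kernel need not be self-adjoint, so no spectral decomposition of \<open>P\<close> is
  at hand. What replaces it is a bound of the bilinear form <u, P v> by a symmetric quadratic form.
  Splitting exp (t f) into two halves places every \<open>P\<close> between two multiplications a_i
  and a_(i+1), and the one-factor estimate is used on both sides of it. Each side contributes a
  square root of r; the two ends of the product supply the remaining square roots through
  Cauchy-Schwarz, so that exactly r_1 * ... * r_n comes out. No operators are composed: all this is
  done with scalar inequalities for bounded measurable functions. The condition on r is implicit,
  since r also occurs in the denominator. From r \<ge> 1 it follows that the explicit condition r
  \<ge> 1 + (s / c^2) * K suffices, with K free of r, and exp (g) \<ge> 1 + g meets it. The constant
  5 has no spectral origin; it is slack that absorbs (exp (t c) - 1)^2 / (1 - lam * exp (t c)) into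
  a rational function of t.\<close>

lemma exp_remainder_sums:
  fixes x :: real
  shows "(\<lambda>n. x ^ (n + 2) / fact (n + 2)) sums (exp x - 1 - x)"
proof -
  have "(\<lambda>n. inverse (fact (n + 2)) * x ^ (n + 2)) sums (\<Sum>n. inverse (fact (n + 2)) * x ^ (n + 2))"
    by (intro summable_sums summable_ignore_initial_segment summable_exp)
  then show ?thesis
    using exp_first_two_terms[of x] by (simp only: divide_inverse mult.commute real_scaleR_def) simp
qed

text \<open>Term by term in the series, |x|^n \<le> c^n keeps just two factors x. After integration
  only the second moment of f remains, and c alone enters the exponential.\<close>

lemma exp_remainder_le:
  fixes c t x :: real
  assumes "0 < c" "\<bar>x\<bar> \<le> c" "0 \<le> t"
  shows "exp (t * x) - 1 - t * x \<le> x\<^sup>2 / c\<^sup>2 * (exp (t * c) - 1 - t * c)"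
proof (rule sums_le[OF _ exp_remainder_sums sums_mult[OF exp_remainder_sums]])
  fix n
  have "x ^ n \<le> c ^ n"
    using power_mono[OF assms(2), of n] power_abs[of x n] by simp
  then have "(t ^ (n + 2) * x\<^sup>2) * x ^ n \<le> (t ^ (n + 2) * x\<^sup>2) * c ^ n"
    using assms by (intro mult_left_mono) auto
  then have "(t * x) ^ (n + 2) \<le> x\<^sup>2 / c\<^sup>2 * (t * c) ^ (n + 2)"
    using \<open>0 < c\<close> by (simp add: power_mult_distrib power_add power2_eq_square mult_ac)
  then have "(t * x) ^ (n + 2) / fact (n + 2) \<le> x\<^sup>2 / c\<^sup>2 * (t * c) ^ (n + 2) / fact (n + 2)"
    by (rule divide_right_mono) simp
  then show "(t * x) ^ (n + 2) / fact (n + 2) \<le> x\<^sup>2 / c\<^sup>2 * ((t * c) ^ (n + 2) / fact (n + 2))"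
    by (simp only: times_divide_eq_right)
qed

text \<open>For x \<ge> 0 this is the chord of the convex function exp over [0, t c]. For x < 0 the
  tangent at 0 gives 1 - exp (t x) \<le> t |x|, and t c \<le> exp (t c) - 1 rescales it.\<close>

lemma exp_minus_one_squared_le:
  fixes c t x :: real
  assumes "0 < c" "\<bar>x\<bar> \<le> c" "0 \<le> t"
  shows "(exp (t * x) - 1)\<^sup>2 \<le> x\<^sup>2 / c\<^sup>2 * (exp (t * c) - 1)\<^sup>2"
proof -
  have "\<bar>exp (t * x) - 1\<bar> \<le> \<bar>x\<bar> / c * (exp (t * c) - 1)"
  proof (cases "x \<ge> 0")
    case True
    have "exp ((1 - x / c) *\<^sub>R 0 + (x / c) *\<^sub>R (t * c)) \<le> (1 - x / c) * exp 0 + (x / c) * exp (t * c)"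
      using assms True by (intro convex_onD[OF exp_convex]) auto
    then show ?thesis using True assms by (simp add: algebra_simps)
  next
    case False
    have "1 - exp (t * x) \<le> - (t * x)" using exp_ge_add_one_self[of "t * x"] by linarith
    also have "\<dots> = - x / c * (t * c)" using assms by simp
    also have "\<dots> \<le> - x / c * (exp (t * c) - 1)"
    proof (rule mult_left_mono)
      show "t * c \<le> exp (t * c) - 1" using exp_ge_add_one_self[of "t * c"] by linarith
      show "0 \<le> - x / c" using False assms by (intro divide_nonneg_pos) auto
    qed
    finally show ?thesis using False assms mult_nonneg_nonpos[of t x] by simp
  qed
  then have "\<bar>exp (t * x) - 1\<bar>\<^sup>2 \<le> (\<bar>x\<bar> / c * (exp (t * c) - 1))\<^sup>2"
    by (intro power_mono) auto
  then show ?thesis by (simp add: power_mult_distrib power_divide)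
qed

text \<open>Since (n + 2)! \<ge> 2 * 3^n, the series is dominated by a geometric one of ratio x / 3.
  This is the source of the value 1/3 of \<open>\<alpha>2\<close> at lam = 0.\<close>

lemma exp_remainder_bernstein:
  fixes x :: real
  assumes "0 \<le> x" "x < 3"
  shows "exp x - 1 - x \<le> x\<^sup>2 / 2 / (1 - x / 3)"
proof -
  have "(\<lambda>n. x\<^sup>2 / 2 * (x / 3) ^ n) sums (x\<^sup>2 / 2 * (1 / (1 - x / 3)))"
    using assms by (intro sums_mult geometric_sums) auto
  moreover have "x ^ (n + 2) / fact (n + 2) \<le> x\<^sup>2 / 2 * (x / 3) ^ n" for n
  proof -
    have "2 * 3 ^ n \<le> (fact (n + 2) :: real)"
    proof (induction n)
      case (Suc n)
      have "2 * 3 ^ Suc n = (3::real) * (2 * 3 ^ n)" by simp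
      also have "\<dots> \<le> real (n + 3) * fact (n + 2)"
        using Suc by (intro mult_mono) auto
      also have "\<dots> = fact (Suc n + 2)" by (simp add: algebra_simps)
      finally show ?case .
    qed simp
    then have "x ^ (n + 2) / fact (n + 2) \<le> x ^ (n + 2) / (2 * 3 ^ n)"
      using assms by (intro divide_left_mono) auto
    then show ?thesis by (simp add: power_divide power_add mult_ac power2_eq_square)
  qed
  ultimately have "exp x - 1 - x \<le> x\<^sup>2 / 2 * (1 / (1 - x / 3))"
    by (rule sums_le[OF _ exp_remainder_sums, rotated])
  then show ?thesis by simp
qed

text \<open>The place where the 5 is spent: one part of 5 t pays for exp t - 1 exceeding t in the
  numerator, the rest for lam * exp t exceeding lam in the denominator.\<close>

lemma exp_minus_one_ratio:
  fixes t lam :: real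
  assumes "0 \<le> t" "0 \<le> lam" "5 * t < 1 - lam"
  shows "lam * exp t < 1"
    and "lam * (exp t - 1)\<^sup>2 / (1 - lam * exp t) \<le> lam * t\<^sup>2 / (1 - lam - 5 * t)"
proof -
  have t: "t < 1 / 5" using assms by simp
  have "exp t - 1 - t \<le> t\<^sup>2 / 2 / (1 - t / 3)"
    using assms t by (intro exp_remainder_bernstein) auto
  \<comment> \<open>t < 1/5 gives 1 - t/3 \<ge> 14/15, and (1/2) / (14/15) = 15/28; the factor 31/28
    below is 1 + 15/28 * 1/5.\<close>
  also have "\<dots> \<le> t\<^sup>2 / 2 / (14 / 15)"
    using assms t by (intro divide_left_mono) auto
  finally have e: "exp t - 1 \<le> t * (1 + 15 / 28 * t)" by (simp add: power2_eq_square algebra_simps)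
  have sm: "1 + 15 / 28 * t \<le> 31 / 28" using t by simp
  have "exp t - 1 \<le> t * (31 / 28)"
    using e mult_left_mono[OF sm \<open>0 \<le> t\<close>] by linarith
  then have "lam * (exp t - 1) \<le> lam * (t * (31 / 28))" using assms by (intro mult_left_mono) auto
  also have "\<dots> \<le> 1 * (t * (31 / 28))" using assms by (intro mult_right_mono) auto
  finally have le: "lam * (exp t - 1) \<le> 31 / 28 * t" by simp
  have split: "lam * exp t = lam + lam * (exp t - 1)" by (simp add: algebra_simps)
  show pos: "lam * exp t < 1" using le split assms by linarith
  have "(1 + 15 / 28 * t)\<^sup>2 \<le> 1 + 2 * t"
  proof -
    have "t * t \<le> t" using assms t by (simp add: mult_left_le)
    then show ?thesis using assms by (simp add: power2_eq_square algebra_simps)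
  qed
  \<comment> \<open>The factor 1 + 2 t costs at most 2 t of the 5 t; the remaining 3 t exceeds the
    31/28 * t needed for lam * exp t.\<close>
  then have "(1 + 15 / 28 * t)\<^sup>2 * (1 - lam - 5 * t) \<le> (1 + 2 * t) * (1 - lam - 5 * t)"
    using assms by (intro mult_right_mono) auto
  also have "\<dots> \<le> 1 - lam - 3 * t"
    using mult_nonneg_nonneg[OF \<open>0 \<le> t\<close> \<open>0 \<le> lam\<close>] mult_nonneg_nonneg[OF \<open>0 \<le> t\<close> \<open>0 \<le> t\<close>]
    by (simp add: algebra_simps)
  also have "\<dots> \<le> 1 - lam * exp t" using le split assms by linarith
  finally have q: "(1 + 15 / 28 * t)\<^sup>2 * (1 - lam - 5 * t) \<le> 1 - lam * exp t" .
  have "(exp t - 1)\<^sup>2 \<le> (t * (1 + 15 / 28 * t))\<^sup>2"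
    using e assms by (intro power_mono) auto
  then have "(exp t - 1)\<^sup>2 * (1 - lam - 5 * t) \<le> (t * (1 + 15 / 28 * t))\<^sup>2 * (1 - lam - 5 * t)"
    using assms by (intro mult_right_mono) auto
  also have "\<dots> = t\<^sup>2 * ((1 + 15 / 28 * t)\<^sup>2 * (1 - lam - 5 * t))"
    by (simp add: power_mult_distrib)
  also have "\<dots> \<le> t\<^sup>2 * (1 - lam * exp t)" using q by (intro mult_left_mono) auto
  finally have "(exp t - 1)\<^sup>2 / (1 - lam * exp t) \<le> t\<^sup>2 / (1 - lam - 5 * t)"
    using pos assms by (simp add: field_simps)
  then show "lam * (exp t - 1)\<^sup>2 / (1 - lam * exp t) \<le> lam * t\<^sup>2 / (1 - lam - 5 * t)"
    using mult_left_mono[OF _ \<open>0 \<le> lam\<close>] by fastforce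
qed

text \<open>An exact Taylor expansion at u = 0: r / (r - lam)^2 is the derivative there. The linear
  term u is kept apart because it integrates to zero for a centred f; the other two terms are of
  second order.\<close>

lemma exp_fraction_expansion:
  fixes lam r u :: real
  assumes "lam < r" "lam * exp u < r"
  shows "exp u / (r - lam * exp u) = 1 / (r - lam) + r / (r - lam)\<^sup>2 *
    (u + (exp u - 1 - u) + lam * (exp u - 1)\<^sup>2 / (r - lam * exp u))"
proof -
  define q d e where "q = exp u" "d = r - lam" "e = r - lam * exp u"
  have [simp]: "d \<noteq> 0" "e \<noteq> 0" using assms by (auto simp: q_d_e_def)
  have r: "r = d + lam" and qe: "lam * q = d + lam - e" by (auto simp: q_d_e_def)
  have "q / e = 1 / d + (d + lam) / d\<^sup>2 * (q - 1 + lam * (q - 1)\<^sup>2 / e)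
     \<longleftrightarrow> q * d\<^sup>2 = d * e + (d + lam) * ((q - 1) * e + lam * (q - 1)\<^sup>2)"
    by (simp add: field_simps power2_eq_square)
  \<comment> \<open>By definition e + lam * (q - 1) = d, so the last bracket collapses to (q - 1) *
    d.\<close>
  also have "\<dots>"
    using qe by algebra
  finally have "q / e = 1 / d + (d + lam) / d\<^sup>2 * (u + (q - 1 - u) + lam * (q - 1)\<^sup>2 / e)"
    by simp
  then show ?thesis by (simp only: q_d_e_def) simp
qed

section \<open>The function \<open>g\<close> and its convex conjugate\<close>

lemma g_linear: "g t lam c s = s * g t lam c 1"
  by (simp add: g_def distrib_left)

text \<open>Links the quantity that the spectral estimate produces to \<open>g\<close>. The bound on
  t is demanded only for lam \<noteq> 0, because at lam = 0 the conjugate is a supremum over all t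
  \<ge> 0 and the estimate must cover them.\<close>

lemma g_ge_second_order:
  assumes "0 \<le> s" "0 < c" "0 \<le> t" "0 \<le> lam" "lam \<noteq> 0 \<Longrightarrow> 5 * c * t < 1 - lam"
  shows "lam * exp (t * c) < 1"
    and "s / c\<^sup>2 * (exp (t * c) - 1 - t * c + lam * (exp (t * c) - 1)\<^sup>2 / (1 - lam * exp (t * c))) \<le> g t lam c s"
proof -
  have ratio: "lam * exp (t * c) < 1 \<and>
    lam * (exp (t * c) - 1)\<^sup>2 / (1 - lam * exp (t * c)) \<le> lam * (t * c)\<^sup>2 / (1 - lam - 5 * c * t)"
  proof (cases "lam = 0")
    case False
    then have "0 \<le> t * c" "5 * (t * c) < 1 - lam" using assms by (auto simp: mult_ac)
    from exp_minus_one_ratio[OF this(1) \<open>0 \<le> lam\<close> this(2)] show ?thesis by (simp add: mult_ac)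
  qed simp
  then show "lam * exp (t * c) < 1" by simp
  have "s / c\<^sup>2 * (exp (t * c) - 1 - t * c + lam * (exp (t * c) - 1)\<^sup>2 / (1 - lam * exp (t * c)))
      \<le> s / c\<^sup>2 * (exp (t * c) - 1 - t * c + lam * (t * c)\<^sup>2 / (1 - lam - 5 * c * t))"
    using ratio assms by (intro mult_left_mono add_left_mono) auto
  also have "\<dots> = g t lam c s"
    using assms by (simp add: g_def distrib_left power_mult_distrib)
  finally show "s / c\<^sup>2 * (exp (t * c) - 1 - t * c + lam * (exp (t * c) - 1)\<^sup>2 / (1 - lam * exp (t * c))) \<le> g t lam c s" .
qed

text \<open>Both summands are brought over the denominator 1 - \<open>\<alpha>2 lam * c * t\<close>:
  the first because \<open>\<alpha>2\<close> is at least 1/3, the second exactly, since for lam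
  \<noteq> 0 this factor times 1 - lam is 1 - lam - 5 c t. The numerators then add up through 1 + 2
  lam / (1 - lam) = \<open>\<alpha>1 lam\<close>.\<close>

lemma g_le_bernstein:
  assumes "0 \<le> s" "0 < c" "0 \<le> t" "0 \<le> lam" "lam < 1" and u: "\<alpha>2 lam * c * t < 1"
  shows "g t lam c s \<le> s * t\<^sup>2 * \<alpha>1 lam / (2 * (1 - \<alpha>2 lam * c * t))"
proof -
  have "0 < 1 - lam" "1 - lam \<le> 1" using assms by auto
  then have \<alpha>2: "1 / 3 \<le> \<alpha>2 lam" by (auto simp: \<alpha>2_def field_simps)
  have "1 / 3 * (c * t) \<le> \<alpha>2 lam * (c * t)" using \<alpha>2 assms by (intro mult_right_mono) auto
  then have ct: "t * c / 3 \<le> \<alpha>2 lam * c * t" by (simp add: mult_ac)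
  have "exp (t * c) - 1 - t * c \<le> (t * c)\<^sup>2 / 2 / (1 - t * c / 3)"
    using ct u assms by (intro exp_remainder_bernstein) auto
  also have "\<dots> \<le> (t * c)\<^sup>2 / 2 / (1 - \<alpha>2 lam * c * t)"
    using ct u by (intro divide_left_mono mult_pos_pos) auto
  finally have "s / c\<^sup>2 * (exp (t * c) - 1 - t * c) \<le> s / c\<^sup>2 * ((t * c)\<^sup>2 / 2 / (1 - \<alpha>2 lam * c * t))"
    using assms by (intro mult_left_mono) auto
  also have "\<dots> = s * t\<^sup>2 / (2 * (1 - \<alpha>2 lam * c * t))"
    using assms by (simp add: power_mult_distrib)
  finally have 1: "s / c\<^sup>2 * (exp (t * c) - 1 - t * c) \<le> s * t\<^sup>2 / (2 * (1 - \<alpha>2 lam * c * t))" .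
  have 2: "s * lam * t\<^sup>2 / (1 - lam - 5 * c * t) = s * t\<^sup>2 * (2 * lam / (1 - lam)) / (2 * (1 - \<alpha>2 lam * c * t))"
  proof (cases "lam = 0")
    case False
    then have "1 - lam - 5 * c * t = (1 - lam) * (1 - \<alpha>2 lam * c * t)"
      using assms by (simp add: \<alpha>2_def field_simps)
    moreover have "s * lam * t\<^sup>2 / (p * q) = s * t\<^sup>2 * (2 * lam / p) / (2 * q)" for p q
      by (simp add: mult_ac)
    ultimately show ?thesis by (simp only:)
  qed simp
  have "g t lam c s \<le> s * t\<^sup>2 / (2 * (1 - \<alpha>2 lam * c * t)) + s * t\<^sup>2 * (2 * lam / (1 - lam)) / (2 * (1 - \<alpha>2 lam * c * t))"
    unfolding g_def 2 using 1 by (rule add_right_mono)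
  also have "\<dots> = s * t\<^sup>2 * (1 + 2 * lam / (1 - lam)) / (2 * (1 - \<alpha>2 lam * c * t))"
    by (simp add: distrib_left add_divide_distrib)
  also have "1 + 2 * lam / (1 - lam) = \<alpha>1 lam" using assms by (simp add: \<alpha>1_def field_simps)
  finally show ?thesis .
qed

lemma gstar_upper:
  assumes "0 \<le> t" "0 < c" "lam < 1" "lam \<noteq> 0 \<Longrightarrow> 5 * c * t < 1 - lam"
  shows "ereal (t * \<epsilon> - g t lam c s) \<le> gstar \<epsilon> lam c s"
  unfolding gstar_def using assms by (intro SUP_upper) (auto simp: field_simps)

lemma gstar_ge_bernstein:
  assumes s: "0 \<le> s" and c: "0 < c" and lam: "0 \<le> lam" "lam < 1" and \<epsilon>: "0 < \<epsilon>"
  shows "ereal ((\<epsilon>\<^sup>2 / 2) / (\<alpha>1 lam * s + \<alpha>2 lam * c * \<epsilon>)) \<le> gstar \<epsilon> lam c s"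
proof -
  define D where "D = \<alpha>1 lam * s + \<alpha>2 lam * c * \<epsilon>"
  have \<alpha>: "0 < \<alpha>1 lam" "0 < \<alpha>2 lam" using lam by (auto simp: \<alpha>1_def \<alpha>2_def)
  then have p: "0 < \<alpha>2 lam * c * \<epsilon>" "0 \<le> \<alpha>1 lam * s" using c \<epsilon> s by auto
  then have D: "0 < D" by (simp add: D_def)
  have dom: "5 * c * t < 1 - lam" if "lam \<noteq> 0" "\<alpha>2 lam * c * t < 1" for t
    using that lam by (simp add: \<alpha>2_def field_simps)
  show ?thesis
  proof (cases "s = 0")
    case True
    \<comment> \<open>With s = 0 the usual choice \<epsilon> / D would give
      \<open>\<alpha>2 lam * c * t = 1\<close>, which is the excluded endpoint. Here g vanishes, so
      half of that value already gives the required bound.\<close>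
    define t where "t = \<epsilon> / (2 * D)"
    have t0: "0 \<le> t" using \<epsilon> D by (simp add: t_def)
    have "\<alpha>2 lam * c * t = 1 / 2" using c \<epsilon> \<alpha> True by (simp add: t_def D_def)
    then have "ereal (t * \<epsilon> - g t lam c s) \<le> gstar \<epsilon> lam c s"
      using c lam t0 by (intro gstar_upper dom) auto
    also have "t * \<epsilon> - g t lam c s = (\<epsilon>\<^sup>2 / 2) / D" using True by (simp add: t_def g_def power2_eq_square)
    finally show ?thesis by (simp add: D_def)
  next
    case False
    define t where "t = \<epsilon> / D"
    have t0: "0 \<le> t" using \<epsilon> D by (simp add: t_def)
    have pos: "0 < \<alpha>1 lam * s" using \<alpha> s False by simp
    have "\<alpha>2 lam * c * t = (D - \<alpha>1 lam * s) / D" by (simp add: t_def D_def)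
    then have u: "1 - \<alpha>2 lam * c * t = \<alpha>1 lam * s / D" using D by (simp add: diff_divide_distrib)
    have u0: "0 < \<alpha>1 lam * s / D" using pos D by simp
    have "g t lam c s \<le> s * t\<^sup>2 * \<alpha>1 lam / (2 * (1 - \<alpha>2 lam * c * t))"
      using u u0 by (intro g_le_bernstein s c t0 lam) linarith
    \<comment> \<open>The factor 1 - \<open>\<alpha>2 lam * c * t\<close> equals
      \<open>\<alpha>1 lam * s / D\<close>, which cancels \<open>s * \<alpha>1 lam\<close>; the
      bound on g is then exactly half of t * \<epsilon>.\<close>
    also have "\<dots> = (\<epsilon>\<^sup>2 / 2) / D"
      unfolding u using D False \<alpha> by (simp add: t_def power2_eq_square)
    finally have "(\<epsilon>\<^sup>2 / 2) / D \<le> t * \<epsilon> - g t lam c s"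
      by (simp add: t_def power2_eq_square)
    then have "ereal ((\<epsilon>\<^sup>2 / 2) / D) \<le> ereal (t * \<epsilon> - g t lam c s)" by simp
    also have "\<dots> \<le> gstar \<epsilon> lam c s"
      using u u0 by (intro gstar_upper dom c t0 lam) linarith+
    finally show ?thesis by (simp add: D_def)
  qed
qed

text \<open>A bound for each t passes to the supremum, attained or not, by taking logarithms: for p
  > 0 the conjugate is at most - ln p / n, hence finite. An infinite conjugate is thus possible only
  for p = 0, which is treated apart.\<close>

lemma le_exp_gstar:
  assumes n: "0 < n" and c: "0 < c" and lam: "lam < 1" and p: "0 \<le> p"
    and le: "\<And>t. 0 \<le> t \<Longrightarrow> (lam \<noteq> 0 \<Longrightarrow> 5 * c * t < 1 - lam) \<Longrightarrow> p \<le> exp (- (n * (t * \<epsilon> - g t lam c s)))"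
  shows "ereal p \<le> exp_ereal (- (ereal n * gstar \<epsilon> lam c s))"
proof (cases "p = 0")
  case True
  then show ?thesis by (auto simp: exp_ereal_def split: ereal.split)
next
  case False
  then have p: "0 < p" using p by simp
  have "gstar \<epsilon> lam c s \<le> ereal (- ln p / n)"
    unfolding gstar_def
  proof (rule SUP_least)
    fix t assume t: "t \<in> (if lam = 0 then {0..} else {0..<(1 - lam) / (5 * c)})"
    then have "p \<le> exp (- (n * (t * \<epsilon> - g t lam c s)))"
      using c by (intro le) (auto simp: field_simps split: if_splits)
    then have "ln p \<le> - (n * (t * \<epsilon> - g t lam c s))" using p ln_le_cancel_iff[of p "exp (- (n * (t * \<epsilon> - g t lam c s)))"] by simp
    then show "ereal (t * \<epsilon> - g t lam c s) \<le> ereal (- ln p / n)" using n by (simp add: field_simps)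
  qed
  moreover have "ereal 0 \<le> gstar \<epsilon> lam c s"
    using gstar_upper[of 0 c lam \<epsilon> s] c lam by (simp add: g_def)
  ultimately obtain r where r: "gstar \<epsilon> lam c s = ereal r" "r \<le> - ln p / n"
    by (cases "gstar \<epsilon> lam c s") auto
  have "p = exp (ln p)" using p by simp
  also have "\<dots> \<le> exp (- (n * r))" using r(2) n by (simp add: field_simps)
  finally show ?thesis by (simp add: r(1) exp_ereal_def)
qed

section \<open>Bounded measurable functions\<close>

text \<open>A class stable under products, exponentials and the kernel, on which integrability is
  automatic. The bound holds everywhere and not almost everywhere, so that it carries over to each
  measure P x, which may charge null sets of \<pi>.\<close>

definition bounded_measurable :: "'a measure \<Rightarrow> ('a \<Rightarrow> real) set" where
  "bounded_measurable M = {h \<in> borel_measurable M. \<exists>B. \<forall>x\<in>space M. \<bar>h x\<bar> \<le> B}"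

lemma bounded_measurableI:
  "h \<in> borel_measurable M \<Longrightarrow> (\<And>x. x \<in> space M \<Longrightarrow> \<bar>h x\<bar> \<le> B) \<Longrightarrow> h \<in> bounded_measurable M"
  by (auto simp: bounded_measurable_def)

lemma bounded_measurableE:
  assumes "h \<in> bounded_measurable M"
  obtains B where "0 \<le> B" "\<forall>x\<in>space M. \<bar>h x\<bar> \<le> B"
proof -
  obtain B where "\<forall>x\<in>space M. \<bar>h x\<bar> \<le> B" using assms by (auto simp: bounded_measurable_def)
  then show thesis by (intro that[of "\<bar>B\<bar>"]) fastforce+
qed

lemma bounded_measurable_borel [measurable_dest]:
  "h \<in> bounded_measurable M \<Longrightarrow> h \<in> borel_measurable M"
  by (simp add: bounded_measurable_def)

lemma bounded_measurable_cong_sets: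
  assumes "sets M = sets N"
  shows "bounded_measurable M = bounded_measurable N"
  unfolding bounded_measurable_def sets_eq_imp_space_eq[OF assms] measurable_cong_sets[OF assms refl] ..

lemma bounded_measurable_const [simp]: "(\<lambda>_. k) \<in> bounded_measurable M"
  by (rule bounded_measurableI[of _ _ "\<bar>k\<bar>"]) auto

lemma bounded_measurable_add:
  assumes "u \<in> bounded_measurable M" "v \<in> bounded_measurable M"
  shows "(\<lambda>x. u x + v x) \<in> bounded_measurable M"
proof -
  note [measurable] = assms
  obtain A where A: "0 \<le> A" "\<forall>x\<in>space M. \<bar>u x\<bar> \<le> A"
    using assms(1) by (rule bounded_measurableE)
  obtain B where B: "0 \<le> B" "\<forall>x\<in>space M. \<bar>v x\<bar> \<le> B"
    using assms(2) by (rule bounded_measurableE)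
  have "\<bar>u x + v x\<bar> \<le> A + B" if "x \<in> space M" for x
    using A(2)[rule_format, OF that] B(2)[rule_format, OF that] by linarith
  then show ?thesis by (intro bounded_measurableI) auto
qed

lemma bounded_measurable_mult:
  assumes "u \<in> bounded_measurable M" "v \<in> bounded_measurable M"
  shows "(\<lambda>x. u x * v x) \<in> bounded_measurable M"
proof -
  note [measurable] = assms
  obtain A where A: "0 \<le> A" "\<forall>x\<in>space M. \<bar>u x\<bar> \<le> A"
    using assms(1) by (rule bounded_measurableE)
  obtain B where B: "0 \<le> B" "\<forall>x\<in>space M. \<bar>v x\<bar> \<le> B"
    using assms(2) by (rule bounded_measurableE)
  have "\<bar>u x * v x\<bar> \<le> A * B" if "x \<in> space M" for x
    unfolding abs_mult using A B that by (intro mult_mono) auto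
  then show ?thesis by (intro bounded_measurableI) auto
qed

lemma bounded_measurable_power2:
  "u \<in> bounded_measurable M \<Longrightarrow> (\<lambda>x. (u x)\<^sup>2) \<in> bounded_measurable M"
  using bounded_measurable_mult[of u M u] by (simp add: power2_eq_square)

lemma bounded_measurable_diff:
  assumes "u \<in> bounded_measurable M" "v \<in> bounded_measurable M"
  shows "(\<lambda>x. u x - v x) \<in> bounded_measurable M"
  using bounded_measurable_add[OF assms(1) bounded_measurable_mult[OF bounded_measurable_const[of "-1"] assms(2)]]
  by simp

lemma bounded_measurable_exp:
  assumes "u \<in> bounded_measurable M"
  shows "(\<lambda>x. exp (u x)) \<in> bounded_measurable M"
proof -
  note [measurable] = assms
  obtain A where "0 \<le> A" "\<forall>x\<in>space M. \<bar>u x\<bar> \<le> A"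
    using assms by (rule bounded_measurableE)
  then have "\<bar>exp (u x)\<bar> \<le> exp A" if "x \<in> space M" for x
    using that by fastforce
  moreover have "(\<lambda>x. exp (u x)) \<in> borel_measurable M" by measurable
  ultimately show ?thesis by (rule bounded_measurableI[rotated])
qed

lemmas bounded_measurable_intros [intro] =
  bounded_measurable_const bounded_measurable_add bounded_measurable_diff
  bounded_measurable_mult bounded_measurable_power2

lemma bounded_measurable_compose:
  assumes "h \<in> bounded_measurable N" "T \<in> L \<rightarrow>\<^sub>M N"
  shows "(\<lambda>\<omega>. h (T \<omega>)) \<in> bounded_measurable L"
  using assms measurable_compose[OF assms(2) bounded_measurable_borel[OF assms(1)]] measurable_space[OF assms(2)]
  by (auto simp: bounded_measurable_def)

lemma bounded_measurable_divide:
  assumes "u \<in> bounded_measurable M" "w \<in> borel_measurable M" "0 < d" "\<And>x. x \<in> space M \<Longrightarrow> d \<le> w x"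
  shows "(\<lambda>x. u x / w x) \<in> bounded_measurable M"
proof -
  note [measurable] = assms(1,2)
  obtain A where "0 \<le> A" "\<forall>x\<in>space M. \<bar>u x\<bar> \<le> A"
    using assms(1) by (rule bounded_measurableE)
  then have "\<bar>u x / w x\<bar> \<le> A / d" if "x \<in> space M" for x
    using that assms(3) assms(4)[OF that] by (auto simp: abs_divide intro!: frac_le)
  then show ?thesis by (intro bounded_measurableI) auto
qed

context prob_space
begin

lemma integrable_bounded_measurable [intro]:
  assumes "h \<in> bounded_measurable M"
  shows "integrable M h"
proof -
  obtain B where "0 \<le> B" "\<forall>x\<in>space M. \<bar>h x\<bar> \<le> B" using assms(1) by (rule bounded_measurableE)
  then show ?thesis
    using bounded_measurable_borel[OF assms] by (intro integrable_const_bound[where B=B]) auto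
qed

text \<open>The quadratic form in (p, q) is nonnegative. Its value at (A, C) is A * (A B - C^2); if
  A = 0, the form is linear in q, which forces C = 0.\<close>

lemma Cauchy_Schwarz_bounded:
  assumes [intro]: "u \<in> bounded_measurable M" "v \<in> bounded_measurable M"
  shows "(expectation (\<lambda>x. u x * v x))\<^sup>2 \<le> expectation (\<lambda>x. (u x)\<^sup>2) * expectation (\<lambda>x. (v x)\<^sup>2)"
proof -
  define A B C where "A = expectation (\<lambda>x. (u x)\<^sup>2)" "B = expectation (\<lambda>x. (v x)\<^sup>2)"
    "C = expectation (\<lambda>x. u x * v x)"
  have [simp]: "integrable M (\<lambda>x. (u x)\<^sup>2)" "integrable M (\<lambda>x. (v x)\<^sup>2)" "integrable M (\<lambda>x. u x * v x)"
    by (auto intro!: integrable_bounded_measurable bounded_measurable_intros)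
  have quad: "0 \<le> p\<^sup>2 * B - 2 * p * q * C + q\<^sup>2 * A" for p q
  proof -
    have "0 \<le> expectation (\<lambda>x. (p * v x - q * u x)\<^sup>2)" by simp
    also have "\<dots> = expectation (\<lambda>x. p\<^sup>2 * (v x)\<^sup>2 - 2 * p * q * (u x * v x) + q\<^sup>2 * (u x)\<^sup>2)"
      by (intro Bochner_Integration.integral_cong) (simp_all add: power2_diff power_mult_distrib mult_ac)
    also have "\<dots> = p\<^sup>2 * B - 2 * p * q * C + q\<^sup>2 * A"
      by (simp add: A_B_C_def)
    finally show ?thesis .
  qed
  have "0 \<le> A" unfolding A_B_C_def by simp
  consider "A > 0" | "A = 0" using \<open>0 \<le> A\<close> by linarith
  then have "C\<^sup>2 \<le> A * B"
  proof cases
    case 1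
    have "0 \<le> A * (A * B - C\<^sup>2)" using quad[of A C] by (simp add: power2_eq_square algebra_simps)
    then show ?thesis using 1 by (simp add: zero_le_mult_iff)
  next
    case 2
    have "C = 0"
    proof (rule ccontr)
      assume "C \<noteq> 0"
      then have "2 * 1 * ((B + 1) / (2 * C)) * C = B + 1" by simp
      then show False using quad[of 1 "(B + 1) / (2 * C)"] 2 by simp
    qed
    then show ?thesis using 2 by simp
  qed
  then show ?thesis by (simp add: A_B_C_def)
qed

end

section \<open>The Leon--Perron form\<close>

context prob_space
begin

definition leon_perron_form :: "real \<Rightarrow> ('a \<Rightarrow> real) \<Rightarrow> real" where
  "leon_perron_form lam h = lam * expectation (\<lambda>x. (h x)\<^sup>2) + (1 - lam) * (expectation h)\<^sup>2"

text \<open>Separates the centred part, on which the gap acts, from the mean, which \<open>P\<close>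
  preserves. Nonnegativity is visible in this shape.\<close>

lemma leon_perron_form_eq_variance:
  assumes "h \<in> bounded_measurable M"
  shows "leon_perron_form lam h = lam * variance h + (expectation h)\<^sup>2"
  using assms by (subst variance_eq) (auto simp: leon_perron_form_def algebra_simps)

lemma leon_perron_form_nonneg:
  assumes "h \<in> bounded_measurable M" "0 \<le> lam"
  shows "0 \<le> leon_perron_form lam h"
  using assms by (simp add: leon_perron_form_eq_variance)

text \<open>Completing the square with k m a / w, where m is the mean of a h. The constant k stays
  outside as a factor, which spares a division by the mean of a^2 / w.\<close>

lemma weighted_square_expectation_le:
  assumes [intro]: "a \<in> bounded_measurable M" "h \<in> bounded_measurable M" "w \<in> bounded_measurable M"
    and w: "0 < d" "\<And>x. x \<in> space M \<Longrightarrow> d \<le> w x"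
    and k: "0 \<le> k" "k * expectation (\<lambda>x. (a x)\<^sup>2 / w x) \<le> 1"
  shows "k * (expectation (\<lambda>x. a x * h x))\<^sup>2 \<le> expectation (\<lambda>x. w x * (h x)\<^sup>2)"
proof -
  define m where "m = expectation (\<lambda>x. a x * h x)"
  have [intro]: "(\<lambda>x. (a x)\<^sup>2 / w x) \<in> bounded_measurable M"
    using w by (intro bounded_measurable_divide[of _ _ _ d]) (auto intro: bounded_measurable_borel)
  have [simp]: "integrable M (\<lambda>x. w x * (h x)\<^sup>2)" "integrable M (\<lambda>x. a x * h x)"
    "integrable M (\<lambda>x. (a x)\<^sup>2 / w x)"
    by (auto intro!: integrable_bounded_measurable bounded_measurable_intros)
  have "0 \<le> expectation (\<lambda>x. w x * (h x - k * m * a x / w x)\<^sup>2)"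
    using w by (intro Bochner_Integration.integral_nonneg mult_nonneg_nonneg zero_le_power2)
      (metis order.trans order.strict_implies_order)
  also have "\<dots> = expectation (\<lambda>x. w x * (h x)\<^sup>2 - 2 * k * m * (a x * h x) + (k * m)\<^sup>2 * ((a x)\<^sup>2 / w x))"
  proof (rule Bochner_Integration.integral_cong)
    fix x assume "x \<in> space M"
    then have "w x \<noteq> 0" using w(1) w(2)[of x] by auto
    then show "w x * (h x - k * m * a x / w x)\<^sup>2 = w x * (h x)\<^sup>2 - 2 * k * m * (a x * h x) + (k * m)\<^sup>2 * ((a x)\<^sup>2 / w x)"
      by (simp add: field_simps power2_eq_square)
  qed simp
  also have "\<dots> = expectation (\<lambda>x. w x * (h x)\<^sup>2) - 2 * k * m * m + (k * m)\<^sup>2 * expectation (\<lambda>x. (a x)\<^sup>2 / w x)"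
    by (simp add: m_def del: times_divide_eq_right)
  \<comment> \<open>One k stays next to the mean of a^2 / w, where the hypothesis bounds the product
    by 1.\<close>
  also have "\<dots> = expectation (\<lambda>x. w x * (h x)\<^sup>2) - 2 * k * m * m + (k * m\<^sup>2) * (k * expectation (\<lambda>x. (a x)\<^sup>2 / w x))"
    by (simp add: power2_eq_square)
  also have "\<dots> \<le> expectation (\<lambda>x. w x * (h x)\<^sup>2) - 2 * k * m * m + (k * m\<^sup>2) * 1"
    using k by (intro add_left_mono mult_left_mono) auto
  finally show ?thesis by (simp add: m_def power2_eq_square)
qed

lemma expectation_exp_fraction_le:
  fixes f :: "'a \<Rightarrow> real"
  assumes f [measurable]: "f \<in> borel_measurable M" and bound: "\<And>x. x \<in> space M \<Longrightarrow> \<bar>f x\<bar> \<le> c"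
    and c: "0 < c" and mean: "expectation f = 0" and t: "0 \<le> t"
    and lam: "0 \<le> lam" "lam * exp (t * c) < 1"
    and r: "r \<ge> 1 + expectation (\<lambda>x. (f x)\<^sup>2) / c\<^sup>2 *
      (exp (t * c) - 1 - t * c + lam * (exp (t * c) - 1)\<^sup>2 / (1 - lam * exp (t * c)))"
  shows "(1 - lam) * expectation (\<lambda>x. exp (t * f x) / (r - lam * exp (t * f x))) \<le> 1"
proof -
  define K where "K = exp (t * c) - 1 - t * c + lam * (exp (t * c) - 1)\<^sup>2 / (1 - lam * exp (t * c))"
  define s where "s = expectation (\<lambda>x. (f x)\<^sup>2)"
  have fb [intro]: "f \<in> bounded_measurable M" using f bound by (rule bounded_measurableI)
  have [simp]: "integrable M f" "integrable M (\<lambda>x. (f x)\<^sup>2)"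
    by (auto intro!: integrable_bounded_measurable bounded_measurable_intros)
  have "0 \<le> s" by (simp add: s_def)
  have K: "0 \<le> K"
    using lam exp_ge_add_one_self[of "t * c"] unfolding K_def
    by (intro add_nonneg_nonneg divide_nonneg_nonneg mult_nonneg_nonneg) (linarith, simp_all)
  have r': "r \<ge> 1 + s / c\<^sup>2 * K" using r by (simp add: K_def s_def)
  then have r1: "1 \<le> r" using K \<open>0 \<le> s\<close> by (smt (verit) divide_nonneg_nonneg mult_nonneg_nonneg zero_le_power2)
  have "lam * 1 \<le> lam * exp (t * c)" using t c lam by (intro mult_left_mono) auto
  then have lam1: "lam < 1" using lam by simp
  have q: "lam * exp (t * f x) \<le> lam * exp (t * c)" if "x \<in> space M" for x
    using bound[OF that] lam t by (intro mult_left_mono) (auto intro: mult_left_mono)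
  \<comment> \<open>A majorant quadratic in f, so that the mean and the second moment of f suffice
    to integrate it. The remainder's denominator is first lowered to 1 - lam * exp (t c), which
    makes \<open>K\<close> independent of r.\<close>
  have pw: "exp (t * f x) / (r - lam * exp (t * f x))
      \<le> 1 / (r - lam) + r / (r - lam)\<^sup>2 * (t * f x + K / c\<^sup>2 * (f x)\<^sup>2)" if x: "x \<in> space M" for x
  proof -
    have "lam * (exp (t * f x) - 1)\<^sup>2 / (r - lam * exp (t * f x))
        \<le> lam * ((f x)\<^sup>2 / c\<^sup>2 * (exp (t * c) - 1)\<^sup>2) / (1 - lam * exp (t * c))"
      using q[OF x] r1 lam exp_minus_one_squared_le[OF c bound[OF x] t]
      by (intro frac_le mult_left_mono) auto
    with exp_remainder_le[OF c bound[OF x] t]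
    have "t * f x + (exp (t * f x) - 1 - t * f x) + lam * (exp (t * f x) - 1)\<^sup>2 / (r - lam * exp (t * f x))
        \<le> t * f x + (f x)\<^sup>2 / c\<^sup>2 * (exp (t * c) - 1 - t * c)
          + lam * ((f x)\<^sup>2 / c\<^sup>2 * (exp (t * c) - 1)\<^sup>2) / (1 - lam * exp (t * c))"
      by linarith
    also have "\<dots> = t * f x + K / c\<^sup>2 * (f x)\<^sup>2"
    proof -
      have "y / d * A + lam * (y / d * B) / D = (A + lam * B / D) / d * y" for y d A B D :: real
        by (simp add: add_divide_distrib ring_distribs mult_ac)
      from this[of "(f x)\<^sup>2" "c\<^sup>2"] show ?thesis by (simp only: K_def add.assoc)
    qed
    finally have le: "t * f x + (exp (t * f x) - 1 - t * f x)
        + lam * (exp (t * f x) - 1)\<^sup>2 / (r - lam * exp (t * f x)) \<le> t * f x + K / c\<^sup>2 * (f x)\<^sup>2" .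
    have "lam < r" "lam * exp (t * f x) < r" using q[OF x] lam lam1 r1 by linarith+
    from exp_fraction_expansion[OF this] show ?thesis
      using le r1 by (auto intro!: add_left_mono mult_left_mono simp del: times_divide_eq_right times_divide_eq_left)
  qed
  have wpos: "1 - lam * exp (t * c) \<le> r - lam * exp (t * f x)" if "x \<in> space M" for x
    using q[OF that] r1 by simp
  have fb2 [intro]: "(\<lambda>x. exp (t * f x)) \<in> bounded_measurable M"
    by (intro bounded_measurable_exp bounded_measurable_mult bounded_measurable_const fb)
  have int: "(\<lambda>x. exp (t * f x) / (r - lam * exp (t * f x))) \<in> bounded_measurable M"
    using wpos lam by (intro bounded_measurable_divide[where d="1 - lam * exp (t * c)"] fb2) auto
  have "expectation (\<lambda>x. exp (t * f x) / (r - lam * exp (t * f x)))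
      \<le> expectation (\<lambda>x. 1 / (r - lam) + r / (r - lam)\<^sup>2 * (t * f x + K / c\<^sup>2 * (f x)\<^sup>2))"
    by (intro integral_mono integrable_bounded_measurable int pw bounded_measurable_intros fb) assumption
  also have "\<dots> = 1 / (r - lam) + r / (r - lam)\<^sup>2 * (t * expectation f + K / c\<^sup>2 * s)"
    by (simp add: s_def prob_space del: times_divide_eq_right times_divide_eq_left)
  also have "\<dots> = 1 / (r - lam) * (1 + r / (r - lam) * (s / c\<^sup>2 * K))"
  proof -
    have "1 / d + r / d\<^sup>2 * (t * 0 + K / b * s) = 1 / d * (1 + r / d * (s / b * K))" for d b
      by (simp add: power2_eq_square distrib_left mult_ac)
    then show ?thesis by (simp only: mean)
  qed
  finally have "(1 - lam) * expectation (\<lambda>x. exp (t * f x) / (r - lam * exp (t * f x)))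
      \<le> (1 - lam) * (1 / (r - lam) * (1 + r / (r - lam) * (s / c\<^sup>2 * K)))"
    using lam1 by (intro mult_left_mono) auto
  also have "\<dots> = (1 / (r - lam)) * ((1 - lam) + (1 - lam) * r / (r - lam) * (s / c\<^sup>2 * K))"
  proof -
    have "p * (1 / d * (1 + r / d * y)) = (1 / d) * (p + p * r / d * y)" for p d y
      by (simp add: distrib_left)
    then show ?thesis .
  qed
  \<comment> \<open>From r \<ge> 1 follows (1 - lam) * r \<le> r - lam. What is left is 1 - lam + (s
    / c^2) * K \<le> r - lam, the hypothesis on r.\<close>
  also have "\<dots> \<le> (1 / (r - lam)) * ((1 - lam) + 1 * (s / c\<^sup>2 * K))"
  proof (intro mult_left_mono add_left_mono mult_right_mono)
    have "lam * 1 \<le> lam * r" using lam r1 by (intro mult_left_mono) auto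
    then show "(1 - lam) * r / (r - lam) \<le> 1" using lam1 r1
      by (subst pos_divide_le_eq) (simp_all add: algebra_simps)
  qed (use lam1 r1 K \<open>0 \<le> s\<close> in auto)
  also have "\<dots> \<le> (1 / (r - lam)) * (r - lam)"
    using r' lam1 r1 by (intro mult_left_mono) auto
  also have "\<dots> = 1" using lam1 r1 by simp
  finally show ?thesis .
qed

text \<open>Moving the lam part of the form to the right leaves the weight r - lam * exp (t f). The
  claim for all h, in effect an operator norm bound, thus reduces to one scalar condition on f and
  r.\<close>

lemma leon_perron_form_exp_le:
  fixes f :: "'a \<Rightarrow> real"
  assumes f [measurable]: "f \<in> borel_measurable M" and bound: "\<And>x. x \<in> space M \<Longrightarrow> \<bar>f x\<bar> \<le> c"
    and c: "0 < c" and mean: "expectation f = 0" and t: "0 \<le> t"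
    and lam: "0 \<le> lam" "lam * exp (t * c) < 1"
    and r: "r \<ge> 1 + expectation (\<lambda>x. (f x)\<^sup>2) / c\<^sup>2 *
      (exp (t * c) - 1 - t * c + lam * (exp (t * c) - 1)\<^sup>2 / (1 - lam * exp (t * c)))"
    and h [intro]: "h \<in> bounded_measurable M"
  shows "leon_perron_form lam (\<lambda>x. exp (t * f x / 2) * h x) \<le> r * expectation (\<lambda>x. (h x)\<^sup>2)"
proof -
  have fb [intro]: "f \<in> bounded_measurable M" using f bound by (rule bounded_measurableI)
  have sq: "(exp (t * f x / 2))\<^sup>2 = exp (t * f x)" for x by (simp flip: exp_double)
  have hb: "(\<lambda>x. exp (t * f x / 2)) \<in> bounded_measurable M"
    using bounded_measurable_exp[OF bounded_measurable_mult[OF bounded_measurable_const[of "t / 2"] fb]] by simp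
  have eb [intro]: "(\<lambda>x. exp (t * f x)) \<in> bounded_measurable M"
    by (intro bounded_measurable_exp bounded_measurable_mult bounded_measurable_const fb)
  have "0 \<le> exp (t * c) - 1 - t * c + lam * (exp (t * c) - 1)\<^sup>2 / (1 - lam * exp (t * c))"
    using lam exp_ge_add_one_self[of "t * c"]
    by (intro add_nonneg_nonneg divide_nonneg_nonneg mult_nonneg_nonneg) (linarith, simp_all)
  then have r1: "1 \<le> r" using r
    by (smt (verit) divide_nonneg_nonneg mult_nonneg_nonneg zero_le_power2 Bochner_Integration.integral_nonneg)
  have "lam * 1 \<le> lam * exp (t * c)" using t c lam by (intro mult_left_mono) auto
  then have lam1: "lam < 1" using lam by simp
  have q: "1 - lam * exp (t * c) \<le> r - lam * exp (t * f x)" if "x \<in> space M" for x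
  proof -
    have "lam * exp (t * f x) \<le> lam * exp (t * c)"
      using bound[OF that] lam t by (intro mult_left_mono) (auto intro: mult_left_mono)
    then show ?thesis using r1 by simp
  qed
  have [simp]: "integrable M (\<lambda>x. (h x)\<^sup>2)" "integrable M (\<lambda>x. exp (t * f x) * (h x)\<^sup>2)"
    by (auto intro!: integrable_bounded_measurable bounded_measurable_intros)
  have "(1 - lam) * (expectation (\<lambda>x. exp (t * f x / 2) * h x))\<^sup>2
      \<le> expectation (\<lambda>x. (r - lam * exp (t * f x)) * (h x)\<^sup>2)"
  proof (rule weighted_square_expectation_le[where d="1 - lam * exp (t * c)"])
    show "(1 - lam) * expectation (\<lambda>x. (exp (t * f x / 2))\<^sup>2 / (r - lam * exp (t * f x))) \<le> 1"
      unfolding sq by (rule expectation_exp_fraction_le[OF f bound c mean t lam r])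
    show "(\<lambda>x. r - lam * exp (t * f x)) \<in> bounded_measurable M"
      by (intro bounded_measurable_intros eb)
  qed (use lam lam1 q hb h in simp_all)
  also have "\<dots> = expectation (\<lambda>x. r * (h x)\<^sup>2 - lam * (exp (t * f x) * (h x)\<^sup>2))"
    by (simp add: algebra_simps)
  also have "\<dots> = r * expectation (\<lambda>x. (h x)\<^sup>2) - lam * expectation (\<lambda>x. exp (t * f x) * (h x)\<^sup>2)"
    by simp
  finally show ?thesis by (simp add: leon_perron_form_def power_mult_distrib sq)
qed

end

section \<open>Kernels with an invariant distribution\<close>

text \<open>Stated in \<open>ennreal\<close> because it is applied under each P x, where an h in
  \<open>L2 \<pi>\<close> may fail to be square integrable. The right side is then infinite, so the
  value of the Bochner integral on the left does not matter.\<close>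

lemma (in prob_space) ennreal_expectation_square_le:
  fixes h :: "'a \<Rightarrow> real"
  assumes [measurable]: "h \<in> borel_measurable M"
  shows "ennreal ((expectation h)\<^sup>2) \<le> (\<integral>\<^sup>+x. ennreal ((h x)\<^sup>2) \<partial>M)"
proof (cases "integrable M (\<lambda>x. (h x)\<^sup>2)")
  case True
  have "0 \<le> variance h" by simp
  then have "(expectation h)\<^sup>2 \<le> expectation (\<lambda>x. (h x)\<^sup>2)"
    using square_integrable_imp_integrable[OF assms True] True by (simp add: variance_eq)
  then show ?thesis using True by (subst nn_integral_eq_integral) (auto intro: ennreal_leI)
next
  case False
  have "(\<integral>\<^sup>+x. ennreal ((h x)\<^sup>2) \<partial>M) = \<infinity>"
  proof (rule ccontr)
    assume "(\<integral>\<^sup>+x. ennreal ((h x)\<^sup>2) \<partial>M) \<noteq> \<infinity>"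
    then have "integrable M (\<lambda>x. (h x)\<^sup>2)"
      by (intro integrableI_nonneg) (auto simp: less_top)
    with False show False ..
  qed
  then show ?thesis by simp
qed

locale invariant_kernel = prob_space \<pi> for \<pi> :: "'a measure" +
  fixes P :: "'a \<Rightarrow> 'a measure"
  assumes kernel [measurable]: "P \<in> \<pi> \<rightarrow>\<^sub>M prob_algebra \<pi>"
    and invariant: "\<pi> \<bind> P = \<pi>"
begin

lemma kernel_subprob [measurable]: "P \<in> \<pi> \<rightarrow>\<^sub>M subprob_algebra \<pi>"
  by (rule measurable_prob_algebraD[OF kernel])

lemma
  assumes "x \<in> space \<pi>"
  shows prob_space_kernel: "prob_space (P x)"
    and sets_kernel: "sets (P x) = sets \<pi>"
  using measurable_space[OF kernel assms] by (auto simp: space_prob_algebra)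

lemma bounded_measurable_kernel:
  assumes "x \<in> space \<pi>"
  shows "bounded_measurable (P x) = bounded_measurable \<pi>"
  using sets_kernel[OF assms] by (rule bounded_measurable_cong_sets)

lemma nn_integral_kernel:
  assumes "u \<in> borel_measurable \<pi>"
  shows "(\<integral>\<^sup>+x. (\<integral>\<^sup>+y. u y \<partial>P x) \<partial>\<pi>) = (\<integral>\<^sup>+x. u x \<partial>\<pi>)"
  using nn_integral_bind[OF assms kernel_subprob] by (simp add: invariant)

lemma borel_measurable_kernel_apply [measurable]:
  assumes [measurable]: "h \<in> borel_measurable \<pi>"
  shows "kernel_apply P h \<in> borel_measurable \<pi>"
  unfolding kernel_apply_def[abs_def]
  using measurable_compose[OF kernel_subprob integral_measurable_subprob_algebra[OF assms]] .

lemma kernel_apply_bounded_measurable [intro]: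
  assumes h: "h \<in> bounded_measurable \<pi>"
  shows "kernel_apply P h \<in> bounded_measurable \<pi>"
proof -
  obtain B where B: "0 \<le> B" "\<forall>x\<in>space \<pi>. \<bar>h x\<bar> \<le> B" using h by (rule bounded_measurableE)
  show ?thesis
  proof (rule bounded_measurableI)
    show "kernel_apply P h \<in> borel_measurable \<pi>"
      using bounded_measurable_borel[OF h] by (rule borel_measurable_kernel_apply)
    fix x assume x: "x \<in> space \<pi>"
    interpret Px: prob_space "P x" by (rule prob_space_kernel[OF x])
    have "integrable (P x) h"
      using h bounded_measurable_kernel[OF x] by (auto intro: Px.integrable_bounded_measurable)
    then have "\<bar>kernel_apply P h x\<bar> \<le> (\<integral>y. \<bar>h y\<bar> \<partial>P x)"
      unfolding kernel_apply_def by (intro integral_abs_bound)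
    also have "\<dots> \<le> (\<integral>y. B \<partial>P x)"
      using \<open>integrable (P x) h\<close> B sets_eq_imp_space_eq[OF sets_kernel[OF x]]
      by (intro integral_mono) auto
    also have "\<dots> = B" using Px.prob_space by simp
    finally show "\<bar>kernel_apply P h x\<bar> \<le> B" .
  qed
qed

lemma nn_integral_kernel_apply:
  assumes h: "h \<in> bounded_measurable \<pi>" "\<And>x. x \<in> space \<pi> \<Longrightarrow> 0 \<le> h x" and x: "x \<in> space \<pi>"
  shows "(\<integral>\<^sup>+y. ennreal (h y) \<partial>P x) = ennreal (kernel_apply P h x)"
proof -
  interpret Px: prob_space "P x" by (rule prob_space_kernel[OF x])
  show ?thesis unfolding kernel_apply_def
    using h bounded_measurable_kernel[OF x] sets_eq_imp_space_eq[OF sets_kernel[OF x]]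
    by (intro nn_integral_eq_integral) auto
qed

lemma kernel_apply_add_const:
  assumes h: "h \<in> bounded_measurable \<pi>" and x: "x \<in> space \<pi>"
  shows "kernel_apply P (\<lambda>y. h y + k) x = kernel_apply P h x + k"
proof -
  interpret Px: prob_space "P x" by (rule prob_space_kernel[OF x])
  have "integrable (P x) h"
    using h bounded_measurable_kernel[OF x] by (auto intro: Px.integrable_bounded_measurable)
  then show ?thesis by (simp add: kernel_apply_def Px.prob_space)
qed

text \<open>Adding the bound B makes h nonnegative; invariance is then the identity for nonnegative
  integrals over a bind, and B cancels because each P x has mass one.\<close>

lemma expectation_kernel_apply:
  assumes h: "h \<in> bounded_measurable \<pi>"
  shows "expectation (kernel_apply P h) = expectation h"
proof -
  obtain B where B: "0 \<le> B" "\<forall>x\<in>space \<pi>. \<bar>h x\<bar> \<le> B" using h by (rule bounded_measurableE)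
  define u where "u = (\<lambda>y. h y + B)"
  have u: "u \<in> bounded_measurable \<pi>" unfolding u_def by (intro bounded_measurable_intros h)
  have u0: "0 \<le> u x" if "x \<in> space \<pi>" for x using B that by (force simp: u_def)
  have Pu: "kernel_apply P u \<in> bounded_measurable \<pi>" using u by (rule kernel_apply_bounded_measurable)
  have Pu0: "0 \<le> kernel_apply P u x" if "x \<in> space \<pi>" for x
    unfolding kernel_apply_def using u0 sets_eq_imp_space_eq[OF sets_kernel[OF that]]
    by (intro integral_nonneg_AE AE_I2) auto
  have "ennreal (expectation (kernel_apply P u)) = (\<integral>\<^sup>+x. ennreal (kernel_apply P u x) \<partial>\<pi>)"
    using Pu Pu0 by (intro nn_integral_eq_integral[symmetric]) auto
  also have "\<dots> = (\<integral>\<^sup>+x. (\<integral>\<^sup>+y. ennreal (u y) \<partial>P x) \<partial>\<pi>)"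
    by (intro nn_integral_cong) (simp add: nn_integral_kernel_apply[OF u u0])
  also have "\<dots> = (\<integral>\<^sup>+x. ennreal (u x) \<partial>\<pi>)"
    using bounded_measurable_borel[OF u] by (intro nn_integral_kernel) simp
  also have "\<dots> = ennreal (expectation u)"
    using u u0 by (intro nn_integral_eq_integral) auto
  finally have "expectation (kernel_apply P u) = expectation u"
    using u0 Pu0 by (subst (asm) ennreal_inj) (auto intro!: integral_nonneg_AE AE_I2)
  moreover have "expectation (kernel_apply P u) = expectation (\<lambda>x. kernel_apply P h x + B)"
    unfolding u_def by (intro Bochner_Integration.integral_cong) (simp_all add: kernel_apply_add_const[OF h])
  ultimately show ?thesis
    using integrable_bounded_measurable[OF h] integrable_bounded_measurable[OF kernel_apply_bounded_measurable[OF h]]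
    by (simp add: u_def prob_space)
qed

section \<open>Contraction on \<open>L2\<close> and the spectral gap\<close>

lemma L2_norm_kernel_apply_le:
  assumes "h \<in> L2 \<pi>"
  shows "L2_norm \<pi> (kernel_apply P h) \<le> L2_norm \<pi> h"
proof -
  have h [measurable]: "h \<in> borel_measurable \<pi>" and int: "integrable \<pi> (\<lambda>x. (h x)\<^sup>2)"
    using assms by (auto simp: L2_def)
  \<comment> \<open>Jensen's inequality at each x, to be followed by invariance of \<pi>.\<close>
  have "(\<integral>\<^sup>+x. ennreal ((kernel_apply P h x)\<^sup>2) \<partial>\<pi>) \<le> (\<integral>\<^sup>+x. (\<integral>\<^sup>+y. ennreal ((h y)\<^sup>2) \<partial>P x) \<partial>\<pi>)"
  proof (intro nn_integral_mono)
    fix x assume x: "x \<in> space \<pi>"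
    interpret Px: prob_space "P x" by (rule prob_space_kernel[OF x])
    show "ennreal ((kernel_apply P h x)\<^sup>2) \<le> (\<integral>\<^sup>+y. ennreal ((h y)\<^sup>2) \<partial>P x)"
      unfolding kernel_apply_def
      using h by (intro Px.ennreal_expectation_square_le) (simp only: measurable_cong_sets[OF sets_kernel[OF x] refl])
  qed
  also have "\<dots> = (\<integral>\<^sup>+x. ennreal ((h x)\<^sup>2) \<partial>\<pi>)" by (intro nn_integral_kernel) simp
  also have "\<dots> = ennreal (\<integral>x. (h x)\<^sup>2 \<partial>\<pi>)" using int by (intro nn_integral_eq_integral) auto
  finally have "enn2real (\<integral>\<^sup>+x. ennreal ((kernel_apply P h x)\<^sup>2) \<partial>\<pi>) \<le> (\<integral>x. (h x)\<^sup>2 \<partial>\<pi>)"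
    by (intro enn2real_leI) auto
  then have "(\<integral>x. (kernel_apply P h x)\<^sup>2 \<partial>\<pi>) \<le> (\<integral>x. (h x)\<^sup>2 \<partial>\<pi>)"
    by (subst integral_eq_nn_integral) auto
  then show ?thesis by (simp add: L2_norm_def)
qed

text \<open>A real \<open>Sup\<close> can be used as an upper bound only for a set that is bounded
  above; contraction provides the bound 1.\<close>

lemma kernel_lambda_bdd_above:
  "bdd_above (insert 0 {L2_norm \<pi> (kernel_apply P h) | h. h \<in> L2_0 \<pi> \<and> L2_norm \<pi> h = 1})"
proof (rule bdd_aboveI)
  fix y assume "y \<in> insert 0 {L2_norm \<pi> (kernel_apply P h) | h. h \<in> L2_0 \<pi> \<and> L2_norm \<pi> h = 1}"
  then show "y \<le> 1" using L2_norm_kernel_apply_le by (force simp: L2_0_def)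
qed

lemma kernel_lambda_nonneg: "0 \<le> kernel_lambda \<pi> P"
  unfolding kernel_lambda_def by (intro cSup_upper kernel_lambda_bdd_above) simp

lemma L2_norm_kernel_apply_le_kernel_lambda:
  assumes h: "h \<in> L2_0 \<pi>"
  shows "L2_norm \<pi> (kernel_apply P h) \<le> kernel_lambda \<pi> P * L2_norm \<pi> h"
proof (cases "L2_norm \<pi> h = 0")
  \<comment> \<open>A function of norm zero cannot be normalised; contraction shows that its image
    has norm zero too.\<close>
  case True
  then show ?thesis using L2_norm_kernel_apply_le[of h] h by (simp add: L2_0_def)
next
  case False
  define r where "r = L2_norm \<pi> h"
  have r: "0 < r" using False by (simp add: r_def L2_norm_def less_le)
  have scale: "L2_norm \<pi> (\<lambda>x. u x / r) = L2_norm \<pi> u / r" for u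
    using r by (simp add: L2_norm_def power_divide real_sqrt_divide)
  have "(\<lambda>x. h x / r) \<in> L2_0 \<pi>"
    using h by (auto simp: L2_0_def L2_def power_divide)
  moreover have "L2_norm \<pi> (\<lambda>x. h x / r) = 1" using r by (simp add: scale r_def[symmetric])
  ultimately have "L2_norm \<pi> (kernel_apply P (\<lambda>x. h x / r)) \<le> kernel_lambda \<pi> P"
    unfolding kernel_lambda_def by (intro cSup_upper kernel_lambda_bdd_above) blast
  also have "kernel_apply P (\<lambda>x. h x / r) = (\<lambda>x. kernel_apply P h x / r)"
    by (simp add: kernel_apply_def fun_eq_iff)
  finally show ?thesis using r by (simp add: scale r_def[symmetric] field_simps)
qed

text \<open>\<open>P\<close> fixes constants and preserves means, so the pairing splits into a
  centred part, at most lam A B in absolute value, and a product of means. Cauchy-Schwarz in the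
  plane then recombines them into two values of the form. The kernel itself is not symmetric; the
  bound is.\<close>

lemma expectation_mult_kernel_apply_le:
  assumes u: "u \<in> bounded_measurable \<pi>" and v: "v \<in> bounded_measurable \<pi>"
  shows "(expectation (\<lambda>x. u x * kernel_apply P v x))\<^sup>2
    \<le> leon_perron_form (kernel_lambda \<pi> P) u * leon_perron_form (kernel_lambda \<pi> P) v"
proof -
  define lam where "lam = kernel_lambda \<pi> P"
  define a b where "a = expectation u" and "b = expectation v"
  define u0 v0 where "u0 = (\<lambda>x. u x - a)" and "v0 = (\<lambda>x. v x - b)"
  define A B where "A = L2_norm \<pi> u0" and "B = L2_norm \<pi> v0"
  define D where "D = expectation (\<lambda>x. u0 x * kernel_apply P v0 x)"
  have lam: "0 \<le> lam" by (simp add: lam_def kernel_lambda_nonneg)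
  have nonneg: "0 \<le> A" "0 \<le> B" by (simp_all add: A_def B_def L2_norm_def)
  have u0: "u0 \<in> bounded_measurable \<pi>" and v0: "v0 \<in> bounded_measurable \<pi>"
    unfolding u0_def v0_def by (intro bounded_measurable_intros u v)+
  have Pv0: "kernel_apply P v0 \<in> bounded_measurable \<pi>" using v0 by (rule kernel_apply_bounded_measurable)
  have Eu0: "expectation u0 = 0" and Ev0: "expectation v0 = 0"
    using integrable_bounded_measurable[OF u] integrable_bounded_measurable[OF v]
    by (simp_all add: u0_def v0_def a_def b_def prob_space)
  have "D\<^sup>2 \<le> expectation (\<lambda>x. (u0 x)\<^sup>2) * expectation (\<lambda>x. (kernel_apply P v0 x)\<^sup>2)"
    unfolding D_def by (rule Cauchy_Schwarz_bounded[OF u0 Pv0])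
  also have "\<dots> = (A * L2_norm \<pi> (kernel_apply P v0))\<^sup>2"
    by (simp add: A_def L2_norm_def power_mult_distrib)
  also have "\<dots> \<le> (A * (lam * B))\<^sup>2"
  proof (intro power_mono mult_left_mono)
    have "v0 \<in> L2_0 \<pi>" using v0 Ev0 by (auto simp: L2_0_def L2_def)
    then show "L2_norm \<pi> (kernel_apply P v0) \<le> lam * B"
      unfolding lam_def B_def by (rule L2_norm_kernel_apply_le_kernel_lambda)
  qed (use nonneg in \<open>auto simp: L2_norm_def\<close>)
  finally have "D\<^sup>2 \<le> (A * (lam * B))\<^sup>2" .
  then have D: "\<bar>D\<bar> \<le> lam * (A * B)"
    using nonneg lam abs_le_square_iff[of D "A * (lam * B)"] by (simp add: mult_ac)
  have "expectation (\<lambda>x. u x * kernel_apply P v x)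
      = expectation (\<lambda>x. u0 x * kernel_apply P v0 x + b * u0 x + a * kernel_apply P v0 x + a * b)"
  proof (intro Bochner_Integration.integral_cong refl)
    fix x assume x: "x \<in> space \<pi>"
    have "kernel_apply P v x = kernel_apply P v0 x + b"
      unfolding v0_def using kernel_apply_add_const[OF v x, of "- b"] by simp
    then show "u x * kernel_apply P v x = u0 x * kernel_apply P v0 x + b * u0 x + a * kernel_apply P v0 x + a * b"
      by (simp add: u0_def algebra_simps)
  qed
  \<comment> \<open>The cross terms vanish: u0 is centred, and so is the image of v0, by
    invariance.\<close>
  also have "\<dots> = D + a * b"
    using integrable_bounded_measurable[OF bounded_measurable_mult[OF u0 Pv0]]
      integrable_bounded_measurable[OF u0] integrable_bounded_measurable[OF Pv0]
    by (simp add: D_def Eu0 Ev0 expectation_kernel_apply[OF v0] prob_space)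
  finally have "(expectation (\<lambda>x. u x * kernel_apply P v x))\<^sup>2 = \<bar>D + a * b\<bar>\<^sup>2" by simp
  also have "\<dots> \<le> (lam * (A * B) + \<bar>a\<bar> * \<bar>b\<bar>)\<^sup>2"
    using D abs_triangle_ineq[of D "a * b"] by (intro power_mono) (auto simp: abs_mult)
  \<comment> \<open>The added square is the defect in the planar Cauchy-Schwarz inequality for (sqrt
    lam * A, |a|) and (sqrt lam * B, |b|).\<close>
  also have "\<dots> \<le> (lam * (A * B) + \<bar>a\<bar> * \<bar>b\<bar>)\<^sup>2 + lam * (A * \<bar>b\<bar> - B * \<bar>a\<bar>)\<^sup>2"
    using lam by simp
  also have "\<dots> = (lam * A\<^sup>2 + \<bar>a\<bar>\<^sup>2) * (lam * B\<^sup>2 + \<bar>b\<bar>\<^sup>2)" by algebra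
  also have "\<dots> = leon_perron_form lam u * leon_perron_form lam v"
    unfolding leon_perron_form_eq_variance[OF u] leon_perron_form_eq_variance[OF v]
    by (simp add: A_def B_def L2_norm_def u0_def v0_def a_def b_def)
  finally show ?thesis by (simp add: lam_def)
qed

end

text \<open>\<open>backward P F i m x\<close> is the conditional expectation of
  \<open>\<Prod>j=i+1..i+m. F j (X j)\<close> given \<open>X i = x\<close>.\<close>

primrec backward ::
  "('a \<Rightarrow> 'a measure) \<Rightarrow> (nat \<Rightarrow> 'a \<Rightarrow> real) \<Rightarrow> nat \<Rightarrow> nat \<Rightarrow> 'a \<Rightarrow> real"
where
  "backward P F i 0 = (\<lambda>_. 1)"
| "backward P F i (Suc m) = kernel_apply P (\<lambda>y. F (Suc i) y * backward P F (Suc i) m y)"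

section \<open>Norm bounds along the backward recursion\<close>

context invariant_kernel
begin

lemma backward_bounded_measurable:
  assumes "\<And>j. F j \<in> bounded_measurable \<pi>"
  shows "backward P F i m \<in> bounded_measurable \<pi>"
proof (induction m arbitrary: i)
  case (Suc m)
  show ?case unfolding backward.simps
    by (intro kernel_apply_bounded_measurable bounded_measurable_mult assms Suc)
qed simp

lemma backward_nonneg:
  assumes "\<And>j x. x \<in> space \<pi> \<Longrightarrow> 0 \<le> F j x" and "x \<in> space \<pi>"
  shows "0 \<le> backward P F i m x"
  using assms(2)
proof (induction m arbitrary: i x)
  case (Suc m)
  then show ?case
    unfolding backward.simps kernel_apply_def
    using assms(1) sets_eq_imp_space_eq[OF sets_kernel[OF Suc.prems]]
    by (intro integral_nonneg_AE AE_I2 mult_nonneg_nonneg) auto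
qed simp

text \<open>Let N_i be the mean of (a_i w_i)^2, w_i being the backward function. As w_i = P
  (a_(i+1)^2 w_(i+1)), the number N_i is itself a pairing through \<open>P\<close>. The gap and
  \<open>form\<close> give N_i^2 \<le> \<rho>_i N_i \<rho>_(i+1) N_(i+1), and one N_i cancels.
  Iterating, \<rho>_i appears once and every later \<rho>_j twice; a final Cauchy-Schwarz step
  supplies the second \<rho>_i and leaves a perfect square.\<close>

lemma expectation_backward_le:
  fixes a :: "nat \<Rightarrow> 'a \<Rightarrow> real" and \<rho> :: "nat \<Rightarrow> real"
  assumes a: "\<And>j. a j \<in> bounded_measurable \<pi>" and \<rho>: "\<And>j. 0 \<le> \<rho> j"
    and form: "\<And>j h. h \<in> bounded_measurable \<pi> \<Longrightarrow>
      leon_perron_form (kernel_lambda \<pi> P) (\<lambda>x. a j x * h x) \<le> \<rho> j * expectation (\<lambda>x. (h x)\<^sup>2)"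
  shows "expectation (\<lambda>x. (a i x)\<^sup>2 * backward P (\<lambda>j x. (a j x)\<^sup>2) i m x) \<le> (\<Prod>j=i..i+m. \<rho> j)"
proof -
  let ?w = "backward P (\<lambda>j x. (a j x)\<^sup>2)"
  define lam where "lam = kernel_lambda \<pi> P"
  have lam: "0 \<le> lam" by (simp add: lam_def kernel_lambda_nonneg)
  have w: "?w i m \<in> bounded_measurable \<pi>" for i m
    by (intro backward_bounded_measurable bounded_measurable_power2 a)
  \<comment> \<open>\<open>form\<close> is used with h = a_j. Taking h = 1 would control the mean of
    a_j and only lam times the mean of a_j^2, whereas h = a_j gives (E a_j^2)^2 \<le> Q (a_j^2)
    \<le> \<rho>_j * E a_j^2.\<close>
  have sq: "expectation (\<lambda>x. (a j x)\<^sup>2) \<le> \<rho> j" for j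
  proof -
    define E where "E = expectation (\<lambda>x. (a j x)\<^sup>2)"
    have "0 \<le> E" by (simp add: E_def)
    have "E\<^sup>2 \<le> expectation (\<lambda>x. ((a j x)\<^sup>2)\<^sup>2)"
      using Cauchy_Schwarz_bounded[OF bounded_measurable_const[of 1] bounded_measurable_power2[OF a[of j]]]
      by (simp add: E_def prob_space)
    then have "E\<^sup>2 \<le> lam * expectation (\<lambda>x. ((a j x)\<^sup>2)\<^sup>2) + (1 - lam) * E\<^sup>2"
      using mult_left_mono[OF _ lam] by (fastforce simp: algebra_simps)
    also have "\<dots> = leon_perron_form lam (\<lambda>x. a j x * a j x)"
      by (simp add: leon_perron_form_def E_def power2_eq_square)
    also have "\<dots> \<le> \<rho> j * E" unfolding E_def lam_def by (rule form[OF a])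
    finally have "E * E \<le> \<rho> j * E" by (simp add: power2_eq_square)
    then show ?thesis using \<rho>[of j] \<open>0 \<le> E\<close> unfolding E_def[symmetric]
      by (cases "E = 0") auto
  qed
  have bw: "expectation (\<lambda>x. (a i x * ?w i m x)\<^sup>2) \<le> \<rho> i * (\<Prod>j=Suc i..i+m. (\<rho> j)\<^sup>2)" for i m
  proof (induction m arbitrary: i)
    case 0
    show ?case using sq by simp
  next
    case (Suc m)
    \<comment> \<open>One factor a is set apart in each function so that \<open>form\<close> can
      consume it; what remains is the function whose square has mean N or N'.\<close>
    define u v where "u = (\<lambda>x. a i x * (a i x * ?w i (Suc m) x))"
      and "v = (\<lambda>x. a (Suc i) x * (a (Suc i) x * ?w (Suc i) m x))"
    define N where "N = expectation (\<lambda>x. (a i x * ?w i (Suc m) x)\<^sup>2)"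
    define N' where "N' = expectation (\<lambda>x. (a (Suc i) x * ?w (Suc i) m x)\<^sup>2)"
    define R where "R = (\<Prod>j=Suc (Suc i)..Suc i+m. (\<rho> j)\<^sup>2)"
    have "0 \<le> N" "0 \<le> N'" by (simp_all add: N_def N'_def)
    have u: "u \<in> bounded_measurable \<pi>" and v: "v \<in> bounded_measurable \<pi>"
      unfolding u_def v_def by (intro bounded_measurable_mult a w)+
    have "(\<lambda>y. (a (Suc i) y)\<^sup>2 * ?w (Suc i) m y) = v"
      by (simp add: v_def power2_eq_square mult_ac)
    then have "N = expectation (\<lambda>x. u x * kernel_apply P v x)"
      by (simp add: N_def u_def power2_eq_square mult_ac)
    then have "N\<^sup>2 \<le> leon_perron_form lam u * leon_perron_form lam v"
      using expectation_mult_kernel_apply_le[OF u v] by (simp add: lam_def)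
    also have "\<dots> \<le> (\<rho> i * N) * (\<rho> (Suc i) * N')"
      unfolding u_def v_def N_def N'_def lam_def
      by (intro mult_mono form bounded_measurable_mult a w mult_nonneg_nonneg \<rho>
          leon_perron_form_nonneg kernel_lambda_nonneg) simp
    also have "\<dots> \<le> (\<rho> i * N) * (\<rho> (Suc i) * (\<rho> (Suc i) * R))"
      using Suc[of "Suc i"] \<open>0 \<le> N\<close> \<rho> unfolding N'_def R_def by (intro mult_left_mono) auto
    finally have "N * N \<le> N * (\<rho> i * ((\<rho> (Suc i))\<^sup>2 * R))"
      by (simp add: power2_eq_square mult_ac)
    moreover have "(\<Prod>j=Suc i..i + Suc m. (\<rho> j)\<^sup>2) = (\<rho> (Suc i))\<^sup>2 * R"
      by (simp add: R_def prod.atLeast_Suc_atMost)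
    moreover have "0 \<le> R" unfolding R_def by (rule prod_nonneg) simp
    ultimately show ?case
      using \<open>0 \<le> N\<close> \<rho>[of i] unfolding N_def[symmetric] by (cases "N = 0") auto
  qed
  show "expectation (\<lambda>x. (a i x)\<^sup>2 * ?w i m x) \<le> (\<Prod>j=i..i+m. \<rho> j)"
  proof (rule power2_le_imp_le)
    have split: "(\<Prod>j=i..i+m. \<rho> j) = \<rho> i * (\<Prod>j=Suc i..i+m. \<rho> j)"
      by (simp add: prod.atLeast_Suc_atMost)
    have "(expectation (\<lambda>x. (a i x)\<^sup>2 * ?w i m x))\<^sup>2 = (expectation (\<lambda>x. a i x * (a i x * ?w i m x)))\<^sup>2"
      by (simp add: power2_eq_square mult_ac)
    also have "\<dots> \<le> expectation (\<lambda>x. (a i x)\<^sup>2) * expectation (\<lambda>x. (a i x * ?w i m x)\<^sup>2)"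
      by (intro Cauchy_Schwarz_bounded bounded_measurable_mult a w)
    also have "\<dots> \<le> \<rho> i * (\<rho> i * (\<Prod>j=Suc i..i+m. (\<rho> j)\<^sup>2))"
      using \<rho> by (intro mult_mono sq bw) auto
    also have "\<dots> = (\<Prod>j=i..i+m. \<rho> j)\<^sup>2"
      unfolding split by (simp add: power_mult_distrib prod_power_distrib power2_eq_square[of "\<rho> i"])
    finally show "(expectation (\<lambda>x. (a i x)\<^sup>2 * ?w i m x))\<^sup>2 \<le> (\<Prod>j=i..i+m. \<rho> j)\<^sup>2" .
    show "0 \<le> (\<Prod>j=i..i+m. \<rho> j)" using \<rho> by (intro prod_nonneg) auto
  qed
qed

end

section \<open>The Markov property\<close>

locale stationary_chain =
  fixes \<Omega> :: "'w measure" and M \<pi> :: "'a measure" and P :: "'a \<Rightarrow> 'a measure"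
    and X :: "nat \<Rightarrow> 'w \<Rightarrow> 'a"
  assumes chain: "stationary_markov_chain \<Omega> M P \<pi> X"
begin

lemma sets_pi: "sets \<pi> = sets M"
  using chain by (simp add: stationary_markov_chain_def invariant_distribution_def)

lemma space_pi: "space \<pi> = space M"
  using sets_pi by (rule sets_eq_imp_space_eq)

lemma distr_X1: "distr \<Omega> M (X 1) = \<pi>"
  using chain by (simp add: stationary_markov_chain_def)

end

sublocale stationary_chain \<subseteq> Om: prob_space \<Omega>
  using chain by (simp add: stationary_markov_chain_def)

sublocale stationary_chain \<subseteq> invariant_kernel \<pi> P
proof -
  have "prob_space \<pi>" "\<pi> \<bind> P = \<pi>" "P \<in> M \<rightarrow>\<^sub>M prob_algebra M"
    using chain by (auto simp: stationary_markov_chain_def invariant_distribution_def markov_kernel_def)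
  moreover have "prob_algebra M = prob_algebra \<pi>"
    by (simp add: prob_algebra_def subprob_algebra_cong[OF sets_pi])
  ultimately have "P \<in> \<pi> \<rightarrow>\<^sub>M prob_algebra \<pi>"
    by (simp only: measurable_cong_sets[OF sets_pi refl])
  with \<open>prob_space \<pi>\<close> \<open>\<pi> \<bind> P = \<pi>\<close> show "invariant_kernel \<pi> P"
    by (simp add: invariant_kernel_def invariant_kernel_axioms_def)
qed

context stationary_chain
begin

lemma X_measurable: "1 \<le> i \<Longrightarrow> X i \<in> \<Omega> \<rightarrow>\<^sub>M \<pi>"
  using chain by (simp only: stationary_markov_chain_def measurable_cong_sets[OF refl sets_pi])

lemma space_past: "space (past \<Omega> M X i) = space \<Omega>"
  unfolding past_def by (subst space_measure_of) auto

lemma sets_past: "sets (past \<Omega> M X i) =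
  sigma_sets (space \<Omega>) {X j -` B \<inter> space \<Omega> | j B. j \<in> {1..i} \<and> B \<in> sets M}"
  unfolding past_def by (subst sets_measure_of) auto

lemma past_mono: "sets (past \<Omega> M X i) \<subseteq> sets (past \<Omega> M X (Suc i))"
  unfolding sets_past by (rule sigma_sets_mono') force

lemma past_subalgebra: "subalgebra \<Omega> (past \<Omega> M X i)"
proof -
  have "sets (past \<Omega> M X i) \<subseteq> sets \<Omega>"
    unfolding sets_past
    by (rule sets.sigma_sets_subset)
      (use X_measurable sets_pi in \<open>auto intro!: measurable_sets\<close>)
  then show ?thesis by (simp add: subalgebra_def space_past)
qed

lemma X_measurable_past:
  assumes "1 \<le> i"
  shows "X i \<in> past \<Omega> M X i \<rightarrow>\<^sub>M \<pi>"
proof (rule measurableI)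
  show "X i \<omega> \<in> space \<pi>" if "\<omega> \<in> space (past \<Omega> M X i)" for \<omega>
    using measurable_space[OF X_measurable[OF assms]] that by (simp add: space_past)
  show "X i -` B \<inter> space (past \<Omega> M X i) \<in> sets (past \<Omega> M X i)" if "B \<in> sets \<pi>" for B
    unfolding space_past unfolding sets_past
    using that assms by (intro sigma_sets.Basic) (auto simp: sets_pi)
qed

lemma bounded_measurable_past_Suc:
  assumes "Z \<in> bounded_measurable (past \<Omega> M X i)"
  shows "Z \<in> bounded_measurable (past \<Omega> M X (Suc i))"
proof -
  have "Z \<in> borel_measurable (past \<Omega> M X (Suc i))"
    using bounded_measurable_borel[OF assms] past_mono
    by (auto simp: measurable_def space_past)
  then show ?thesis using assms by (simp add: bounded_measurable_def space_past)
qed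

text \<open>The conditional expectation in the chain's definition is tested against a bounded
  nonnegative variable of the past. The passage through real integrals is needed because the
  definition speaks of real-valued conditional probabilities.\<close>

lemma nn_integral_markov_indicator:
  assumes i: "1 \<le> i" and Z: "Z \<in> bounded_measurable (past \<Omega> M X i)"
    and Z0: "\<And>\<omega>. \<omega> \<in> space \<Omega> \<Longrightarrow> 0 \<le> Z \<omega>" and B: "B \<in> sets \<pi>"
  shows "(\<integral>\<^sup>+\<omega>. ennreal (Z \<omega>) * indicator B (X (Suc i) \<omega>) \<partial>\<Omega>)
    = (\<integral>\<^sup>+\<omega>. ennreal (Z \<omega>) * emeasure (P (X i \<omega>)) B \<partial>\<Omega>)"
proof -
  let ?F = "past \<Omega> M X i" and ?I = "indicator (X (Suc i) -` B \<inter> space \<Omega>) :: 'w \<Rightarrow> real"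
  interpret finite_measure_subalgebra \<Omega> ?F
    by unfold_locales (rule past_subalgebra)
  have ZO: "Z \<in> bounded_measurable \<Omega>"
    using Z measurable_from_subalg[OF past_subalgebra bounded_measurable_borel[OF Z]]
    by (simp add: bounded_measurable_def space_past)
  note [measurable] = X_measurable[of "Suc i", simplified] X_measurable[OF i] B ZO
  have I: "?I \<in> bounded_measurable \<Omega>"
    by (rule bounded_measurableI[where B=1]) (auto simp: indicator_def)
  have ZI: "integrable \<Omega> (\<lambda>\<omega>. Z \<omega> * ?I \<omega>)"
    using ZO I by (intro Om.integrable_bounded_measurable bounded_measurable_mult)
  have Pm: "(\<lambda>x. measure (P x) B) \<in> bounded_measurable \<pi>"
  proof (rule bounded_measurableI[where B=1])
    show "(\<lambda>x. measure (P x) B) \<in> borel_measurable \<pi>" by measurable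
    show "\<bar>measure (P x) B\<bar> \<le> 1" if "x \<in> space \<pi>" for x
      using prob_space.prob_le_1[OF prob_space_kernel[OF that]] by simp
  qed
  have PX: "(\<lambda>\<omega>. measure (P (X i \<omega>)) B) \<in> bounded_measurable \<Omega>"
    by (rule bounded_measurable_compose[OF Pm X_measurable[OF i]])
  have "AE \<omega> in \<Omega>. real_cond_exp \<Omega> ?F ?I \<omega> = measure (P (X i \<omega>)) B"
    using chain i B by (auto simp: stationary_markov_chain_def sets_pi)
  then have "(\<integral>\<omega>. Z \<omega> * measure (P (X i \<omega>)) B \<partial>\<Omega>) = (\<integral>\<omega>. Z \<omega> * real_cond_exp \<Omega> ?F ?I \<omega> \<partial>\<Omega>)"
    using bounded_measurable_borel[OF PX] by (intro integral_cong_AE) auto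
  also have "\<dots> = (\<integral>\<omega>. Z \<omega> * ?I \<omega> \<partial>\<Omega>)"
    using ZI bounded_measurable_borel[OF Z] bounded_measurable_borel[OF I] by (rule real_cond_exp_intg)
  finally have eq: "(\<integral>\<omega>. Z \<omega> * measure (P (X i \<omega>)) B \<partial>\<Omega>) = (\<integral>\<omega>. Z \<omega> * ?I \<omega> \<partial>\<Omega>)" .
  have "(\<integral>\<^sup>+\<omega>. ennreal (Z \<omega>) * indicator B (X (Suc i) \<omega>) \<partial>\<Omega>) = (\<integral>\<^sup>+\<omega>. ennreal (Z \<omega> * ?I \<omega>) \<partial>\<Omega>)"
    by (intro nn_integral_cong) (auto simp: indicator_def)
  also have "\<dots> = ennreal (\<integral>\<omega>. Z \<omega> * ?I \<omega> \<partial>\<Omega>)"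
    using ZI Z0 by (intro nn_integral_eq_integral) auto
  also have "\<dots> = (\<integral>\<^sup>+\<omega>. ennreal (Z \<omega> * measure (P (X i \<omega>)) B) \<partial>\<Omega>)"
    unfolding eq[symmetric] using Z0 ZO PX
    by (intro nn_integral_eq_integral[symmetric] Om.integrable_bounded_measurable bounded_measurable_mult) auto
  also have "\<dots> = (\<integral>\<^sup>+\<omega>. ennreal (Z \<omega>) * emeasure (P (X i \<omega>)) B \<partial>\<Omega>)"
  proof (intro nn_integral_cong)
    fix \<omega> assume \<omega>: "\<omega> \<in> space \<Omega>"
    interpret Px: prob_space "P (X i \<omega>)"
      using measurable_space[OF X_measurable[OF i] \<omega>] by (rule prob_space_kernel)
    show "ennreal (Z \<omega> * measure (P (X i \<omega>)) B) = ennreal (Z \<omega>) * emeasure (P (X i \<omega>)) B"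
      using Z0[OF \<omega>] by (simp add: ennreal_mult Px.emeasure_eq_measure)
  qed
  finally show ?thesis .
qed

text \<open>Instead of approximating \<phi>, Z is read as a density. The identity for indicators
  then says that, under the weighted measure, the law of X (i + 1) is the law of X i followed by
  \<open>P\<close>; equal measures integrate every nonnegative \<phi> alike.\<close>

lemma nn_integral_markov:
  assumes i: "1 \<le> i" and Z: "Z \<in> bounded_measurable (past \<Omega> M X i)"
    and Z0: "\<And>\<omega>. \<omega> \<in> space \<Omega> \<Longrightarrow> 0 \<le> Z \<omega>" and \<phi> [measurable]: "\<phi> \<in> borel_measurable \<pi>"
  shows "(\<integral>\<^sup>+\<omega>. ennreal (Z \<omega>) * \<phi> (X (Suc i) \<omega>) \<partial>\<Omega>)
    = (\<integral>\<^sup>+\<omega>. ennreal (Z \<omega>) * (\<integral>\<^sup>+y. \<phi> y \<partial>P (X i \<omega>)) \<partial>\<Omega>)"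
proof -
  define D where "D = density \<Omega> (\<lambda>\<omega>. ennreal (Z \<omega>))"
  have [measurable]: "Z \<in> borel_measurable \<Omega>"
    using measurable_from_subalg[OF past_subalgebra bounded_measurable_borel[OF Z]] .
  note X_meas [measurable] = X_measurable[of "Suc i", simplified] X_measurable[OF i]
  have XD [measurable]: "X (Suc i) \<in> D \<rightarrow>\<^sub>M \<pi>" "X i \<in> D \<rightarrow>\<^sub>M \<pi>" unfolding D_def by simp_all
  have ne: "space \<pi> \<noteq> {}" by (rule not_empty)
  have eq: "distr D \<pi> (X (Suc i)) = distr D \<pi> (X i) \<bind> P"
  proof (rule measure_eqI)
    show "sets (distr D \<pi> (X (Suc i))) = sets (distr D \<pi> (X i) \<bind> P)"
      using ne by (subst sets_bind[where N=\<pi>]) (auto simp: sets_kernel)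
    fix B assume "B \<in> sets (distr D \<pi> (X (Suc i)))"
    then have B [measurable]: "B \<in> sets \<pi>" by simp
    have "emeasure (distr D \<pi> (X (Suc i))) B = (\<integral>\<^sup>+x. indicator B x \<partial>distr D \<pi> (X (Suc i)))" by simp
    also have "\<dots> = (\<integral>\<^sup>+\<omega>. indicator B (X (Suc i) \<omega>) \<partial>D)" by (rule nn_integral_distr) auto
    also have "\<dots> = (\<integral>\<^sup>+\<omega>. ennreal (Z \<omega>) * indicator B (X (Suc i) \<omega>) \<partial>\<Omega>)"
      unfolding D_def by (rule nn_integral_density) auto
    also have "\<dots> = (\<integral>\<^sup>+\<omega>. ennreal (Z \<omega>) * emeasure (P (X i \<omega>)) B \<partial>\<Omega>)"
      by (rule nn_integral_markov_indicator[OF i Z Z0 B])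
    also have "\<dots> = (\<integral>\<^sup>+\<omega>. emeasure (P (X i \<omega>)) B \<partial>D)"
      unfolding D_def by (rule nn_integral_density[symmetric]) auto
    also have "\<dots> = (\<integral>\<^sup>+x. emeasure (P x) B \<partial>distr D \<pi> (X i))" by (rule nn_integral_distr[symmetric]) auto
    also have "\<dots> = emeasure (distr D \<pi> (X i) \<bind> P) B"
      using ne by (intro emeasure_bind[symmetric, where N=\<pi>]) auto
    finally show "emeasure (distr D \<pi> (X (Suc i))) B = emeasure (distr D \<pi> (X i) \<bind> P) B" .
  qed
  have "(\<integral>\<^sup>+\<omega>. ennreal (Z \<omega>) * \<phi> (X (Suc i) \<omega>) \<partial>\<Omega>) = (\<integral>\<^sup>+\<omega>. \<phi> (X (Suc i) \<omega>) \<partial>D)"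
    unfolding D_def by (rule nn_integral_density[symmetric]) auto
  also have "\<dots> = (\<integral>\<^sup>+x. \<phi> x \<partial>(distr D \<pi> (X i) \<bind> P))"
    unfolding eq[symmetric] by (rule nn_integral_distr[symmetric]) auto
  also have "\<dots> = (\<integral>\<^sup>+x. (\<integral>\<^sup>+y. \<phi> y \<partial>P x) \<partial>distr D \<pi> (X i))"
    by (rule nn_integral_bind[where B=\<pi>]) auto
  also have "\<dots> = (\<integral>\<^sup>+\<omega>. (\<integral>\<^sup>+y. \<phi> y \<partial>P (X i \<omega>)) \<partial>D)" by (rule nn_integral_distr) auto
  also have "\<dots> = (\<integral>\<^sup>+\<omega>. ennreal (Z \<omega>) * (\<integral>\<^sup>+y. \<phi> y \<partial>P (X i \<omega>)) \<partial>\<Omega>)"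
    unfolding D_def by (rule nn_integral_density) auto
  finally show ?thesis .
qed

text \<open>The past factor Z must be arbitrary in the induction: the factor at i + 1 is absorbed
  into Z, the later ones are integrated out by the induction hypothesis at i + 1, and a single
  Markov step at i remains.\<close>

lemma nn_integral_prod_eq_backward:
  assumes F: "\<And>j. F j \<in> bounded_measurable \<pi>" and F0: "\<And>j x. x \<in> space \<pi> \<Longrightarrow> 0 \<le> F j x"
    and "1 \<le> i" and "Z \<in> bounded_measurable (past \<Omega> M X i)" and "\<And>\<omega>. \<omega> \<in> space \<Omega> \<Longrightarrow> 0 \<le> Z \<omega>"
  shows "(\<integral>\<^sup>+\<omega>. ennreal (Z \<omega> * (\<Prod>j=Suc i..i+m. F j (X j \<omega>))) \<partial>\<Omega>)
    = (\<integral>\<^sup>+\<omega>. ennreal (Z \<omega> * backward P F i m (X i \<omega>)) \<partial>\<Omega>)"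
  using assms(3-)
proof (induction m arbitrary: i Z)
  case (Suc m)
  note i = Suc.prems(1) and Z = Suc.prems(2) and Z0 = Suc.prems(3)
  define \<phi> where "\<phi> = (\<lambda>y. F (Suc i) y * backward P F (Suc i) m y)"
  have \<phi>: "\<phi> \<in> bounded_measurable \<pi>"
    unfolding \<phi>_def by (intro bounded_measurable_mult F backward_bounded_measurable)
  have \<phi>0: "0 \<le> \<phi> x" if "x \<in> space \<pi>" for x
    unfolding \<phi>_def using that by (intro mult_nonneg_nonneg F0 backward_nonneg)
  have X_space: "X j \<omega> \<in> space \<pi>" if "1 \<le> j" "\<omega> \<in> space \<Omega>" for j \<omega>
    using measurable_space[OF X_measurable] that by auto
  define Z' where "Z' = (\<lambda>\<omega>. Z \<omega> * F (Suc i) (X (Suc i) \<omega>))"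
  have Z': "Z' \<in> bounded_measurable (past \<Omega> M X (Suc i))"
    unfolding Z'_def
    by (intro bounded_measurable_mult bounded_measurable_past_Suc Z
        bounded_measurable_compose[OF F X_measurable_past]) simp
  have Z'0: "0 \<le> Z' \<omega>" if "\<omega> \<in> space \<Omega>" for \<omega>
    unfolding Z'_def using that by (intro mult_nonneg_nonneg Z0 F0 X_space) auto
  have split: "(\<Prod>j=Suc i..i + Suc m. q j) = q (Suc i) * (\<Prod>j=Suc (Suc i)..Suc i + m. q j)"
    for q :: "nat \<Rightarrow> real"
    by (subst prod.atLeast_Suc_atMost) simp_all
  have "(\<integral>\<^sup>+\<omega>. ennreal (Z \<omega> * (\<Prod>j=Suc i..i + Suc m. F j (X j \<omega>))) \<partial>\<Omega>)
      = (\<integral>\<^sup>+\<omega>. ennreal (Z' \<omega> * (\<Prod>j=Suc (Suc i)..Suc i + m. F j (X j \<omega>))) \<partial>\<Omega>)"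
    unfolding split by (simp only: Z'_def mult.assoc)
  also have "\<dots> = (\<integral>\<^sup>+\<omega>. ennreal (Z' \<omega> * backward P F (Suc i) m (X (Suc i) \<omega>)) \<partial>\<Omega>)"
    using Z' Z'0 by (intro Suc.IH) auto
  also have "\<dots> = (\<integral>\<^sup>+\<omega>. ennreal (Z \<omega>) * ennreal (\<phi> (X (Suc i) \<omega>)) \<partial>\<Omega>)"
    by (intro nn_integral_cong) (simp add: Z'_def \<phi>_def ennreal_mult'[OF Z0, symmetric] mult_ac)
  also have "\<dots> = (\<integral>\<^sup>+\<omega>. ennreal (Z \<omega>) * (\<integral>\<^sup>+y. ennreal (\<phi> y) \<partial>P (X i \<omega>)) \<partial>\<Omega>)"
    using bounded_measurable_borel[OF \<phi>] by (intro nn_integral_markov i Z Z0) auto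
  also have "\<dots> = (\<integral>\<^sup>+\<omega>. ennreal (Z \<omega> * backward P F i (Suc m) (X i \<omega>)) \<partial>\<Omega>)"
  proof (intro nn_integral_cong)
    fix \<omega> assume \<omega>: "\<omega> \<in> space \<Omega>"
    have "(\<integral>\<^sup>+y. ennreal (\<phi> y) \<partial>P (X i \<omega>)) = ennreal (backward P F i (Suc m) (X i \<omega>))"
      unfolding backward.simps \<phi>_def[symmetric]
      by (rule nn_integral_kernel_apply[OF \<phi> \<phi>0 X_space[OF i \<omega>]])
    then show "ennreal (Z \<omega>) * (\<integral>\<^sup>+y. ennreal (\<phi> y) \<partial>P (X i \<omega>)) = ennreal (Z \<omega> * backward P F i (Suc m) (X i \<omega>))"
      by (simp add: ennreal_mult'[OF Z0[OF \<omega>]])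
  qed
  finally show ?case .
qed simp

lemma expectation_prod_eq_backward:
  assumes F: "\<And>j. F j \<in> bounded_measurable \<pi>" and F0: "\<And>j x. x \<in> space \<pi> \<Longrightarrow> 0 \<le> F j x"
  shows "Om.expectation (\<lambda>\<omega>. \<Prod>j=1..Suc m. F j (X j \<omega>)) = expectation (\<lambda>x. F 1 x * backward P F 1 m x)"
proof -
  define \<psi> where "\<psi> = (\<lambda>x. F 1 x * backward P F 1 m x)"
  have \<psi>: "\<psi> \<in> borel_measurable \<pi>"
    unfolding \<psi>_def by (intro bounded_measurable_borel bounded_measurable_mult F backward_bounded_measurable)
  have \<psi>0: "0 \<le> \<psi> x" if "x \<in> space \<pi>" for x
    unfolding \<psi>_def using that by (intro mult_nonneg_nonneg F0 backward_nonneg)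
  have X1: "X 1 \<in> \<Omega> \<rightarrow>\<^sub>M M" using chain by (simp add: stationary_markov_chain_def)
  have prod0: "0 \<le> (\<Prod>j=1..Suc m. F j (X j \<omega>))" if "\<omega> \<in> space \<Omega>" for \<omega>
    using measurable_space[OF X_measurable] that by (intro prod_nonneg F0) auto
  have F_meas: "(\<lambda>\<omega>. \<Prod>j=1..Suc m. F j (X j \<omega>)) \<in> borel_measurable \<Omega>"
    using measurable_compose[OF X_measurable bounded_measurable_borel[OF F]]
    by (intro borel_measurable_prod) auto
  have split: "(\<Prod>j=1..Suc m. q j) = q 1 * (\<Prod>j=Suc 1..1 + m. q j)" for q :: "nat \<Rightarrow> real"
    by (subst prod.atLeast_Suc_atMost) simp_all
  have "(\<integral>\<^sup>+\<omega>. ennreal (\<Prod>j=1..Suc m. F j (X j \<omega>)) \<partial>\<Omega>)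
      = (\<integral>\<^sup>+\<omega>. ennreal (F 1 (X 1 \<omega>) * (\<Prod>j=Suc 1..1 + m. F j (X j \<omega>))) \<partial>\<Omega>)"
    unfolding split ..
  also have "\<dots> = (\<integral>\<^sup>+\<omega>. ennreal (\<psi> (X 1 \<omega>)) \<partial>\<Omega>)"
    unfolding \<psi>_def
    using measurable_space[OF X_measurable[of 1]]
    \<comment> \<open>The instance i = 1 with Z = F 1 (X 1): the recursion starts inside the chain,
      as X 0 is unconstrained.\<close>
    by (intro nn_integral_prod_eq_backward F F0 bounded_measurable_compose[OF F X_measurable_past]) auto
  also have "\<dots> = (\<integral>\<^sup>+x. ennreal (\<psi> x) \<partial>distr \<Omega> M (X 1))"
    using \<psi> by (intro nn_integral_distr[symmetric] X1) (simp add: measurable_cong_sets[OF sets_pi refl])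
  finally have eq: "(\<integral>\<^sup>+\<omega>. ennreal (\<Prod>j=1..Suc m. F j (X j \<omega>)) \<partial>\<Omega>) = (\<integral>\<^sup>+x. ennreal (\<psi> x) \<partial>\<pi>)"
    by (simp only: distr_X1)
  have "Om.expectation (\<lambda>\<omega>. \<Prod>j=1..Suc m. F j (X j \<omega>)) = enn2real (\<integral>\<^sup>+\<omega>. ennreal (\<Prod>j=1..Suc m. F j (X j \<omega>)) \<partial>\<Omega>)"
    using F_meas prod0 by (intro integral_eq_nn_integral) auto
  also have "\<dots> = expectation \<psi>"
    unfolding eq using \<psi> \<psi>0 by (intro integral_eq_nn_integral[symmetric]) auto
  finally show ?thesis by (simp add: \<psi>_def)
qed

end

section \<open>The Bernstein inequality\<close>

context stationary_chain
begin

lemma expectation_exp_sum_le: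
  fixes f :: "nat \<Rightarrow> 'a \<Rightarrow> real" and n :: nat and c lam t :: real
  assumes lam: "lam = kernel_lambda \<pi> P" and n: "1 \<le> n" and c: "0 < c"
    and f: "\<And>i. i \<in> {1..n} \<Longrightarrow> f i \<in> borel_measurable \<pi>"
    and bound: "\<And>i x. i \<in> {1..n} \<Longrightarrow> x \<in> space \<pi> \<Longrightarrow> \<bar>f i x\<bar> \<le> c"
    and mean: "\<And>i. i \<in> {1..n} \<Longrightarrow> expectation (f i) = 0"
    and t: "0 \<le> t" "lam \<noteq> 0 \<Longrightarrow> 5 * c * t < 1 - lam"
  shows "Om.expectation (\<lambda>\<omega>. exp (t * (\<Sum>i=1..n. f i (X i \<omega>))))
    \<le> exp (real n * g t lam c ((\<Sum>i=1..n. expectation (\<lambda>x. (f i x)\<^sup>2)) / real n))"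
proof -
  \<comment> \<open>The functions are extended by zero beyond n, since the recursion and its norm
    bound ask for their hypotheses at every index.\<close>
  define f' where "f' = (\<lambda>i. if i \<in> {1..n} then f i else (\<lambda>_. 0))"
  define s where "s = (\<lambda>i. expectation (\<lambda>x. (f' i x)\<^sup>2))"
  define a where "a = (\<lambda>i x. exp (t * f' i x / 2))"
  define \<rho> where "\<rho> = (\<lambda>i. exp (g t lam c (s i)))"
  have lam0: "0 \<le> lam" by (simp add: lam kernel_lambda_nonneg)
  have s0: "0 \<le> s i" for i by (simp add: s_def)
  have f'_meas: "f' i \<in> borel_measurable \<pi>" and f'_bound: "x \<in> space \<pi> \<Longrightarrow> \<bar>f' i x\<bar> \<le> c"
    and f'_mean: "expectation (f' i) = 0" for i x
    using f bound mean c by (auto simp: f'_def)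
  have f'_bm: "f' i \<in> bounded_measurable \<pi>" for i
    using f'_meas f'_bound by (rule bounded_measurableI)
  have a_bm: "a i \<in> bounded_measurable \<pi>" for i
    unfolding a_def
    using bounded_measurable_exp[OF bounded_measurable_mult[OF bounded_measurable_const[of "t / 2"] f'_bm[of i]]] by simp
  have sq: "(a i x)\<^sup>2 = exp (t * f' i x)" for i x by (simp add: a_def flip: exp_double)
  have form: "leon_perron_form (kernel_lambda \<pi> P) (\<lambda>x. a i x * h x) \<le> \<rho> i * expectation (\<lambda>x. (h x)\<^sup>2)"
    if h: "h \<in> bounded_measurable \<pi>" for i h
    unfolding a_def lam[symmetric]
  proof (rule leon_perron_form_exp_le[OF f'_meas f'_bound c f'_mean t(1) lam0 _ _ h])
    note second = g_ge_second_order[OF s0[of i] c t(1) lam0 t(2)]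
    show "lam * exp (t * c) < 1" using second(1) by blast
    show "1 + expectation (\<lambda>x. (f' i x)\<^sup>2) / c\<^sup>2 *
      (exp (t * c) - 1 - t * c + lam * (exp (t * c) - 1)\<^sup>2 / (1 - lam * exp (t * c))) \<le> \<rho> i"
      \<comment> \<open>Here exp (g) \<ge> 1 + g turns the multiplicative factor into the additive
        requirement on r.\<close>
      using second(2) exp_ge_add_one_self[of "g t lam c (s i)"] unfolding \<rho>_def s_def by linarith
  qed auto
  obtain m where m: "n = Suc m" using n by (cases n) auto
  have "Om.expectation (\<lambda>\<omega>. exp (t * (\<Sum>i=1..n. f i (X i \<omega>))))
      = Om.expectation (\<lambda>\<omega>. \<Prod>i=1..Suc m. (a i (X i \<omega>))\<^sup>2)"
  proof (intro Bochner_Integration.integral_cong refl)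
    fix \<omega>
    have "exp (t * (\<Sum>i=1..n. f i (X i \<omega>))) = (\<Prod>i=1..n. exp (t * f i (X i \<omega>)))"
      unfolding sum_distrib_left by (simp add: exp_sum)
    also have "\<dots> = (\<Prod>i=1..Suc m. (a i (X i \<omega>))\<^sup>2)"
      unfolding sq by (intro prod.cong) (simp_all add: m f'_def)
    finally show "exp (t * (\<Sum>i=1..n. f i (X i \<omega>))) = (\<Prod>i=1..Suc m. (a i (X i \<omega>))\<^sup>2)" .
  qed
  also have "\<dots> = expectation (\<lambda>x. (a 1 x)\<^sup>2 * backward P (\<lambda>i x. (a i x)\<^sup>2) 1 m x)"
    by (intro expectation_prod_eq_backward bounded_measurable_power2 a_bm zero_le_power2)
  also have "\<dots> \<le> (\<Prod>i=1..1+m. \<rho> i)"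
    by (intro expectation_backward_le a_bm form) (simp_all add: \<rho>_def)
  also have "\<dots> = exp (\<Sum>i=1..n. g t lam c (s i))" by (simp only: \<rho>_def exp_sum finite_atLeastAtMost m plus_1_eq_Suc)
  also have "(\<Sum>i=1..n. g t lam c (s i)) = (\<Sum>i=1..n. expectation (\<lambda>x. (f i x)\<^sup>2)) * g t lam c 1"
    unfolding g_linear[of t lam c "s _"] sum_distrib_right by (intro sum.cong) (simp_all add: s_def f'_def)
  \<comment> \<open>Linearity in the variance again: only the average of the second moments enters,
    although the functions may differ.\<close>
  also have "\<dots> = real n * g t lam c ((\<Sum>i=1..n. expectation (\<lambda>x. (f i x)\<^sup>2)) / real n)"
    using n by (subst (2) g_linear) simp
  finally show ?thesis .
qed

end

theorem theorem1:
  fixes \<Omega> :: "'w measure" and M \<pi> :: "'a measure" and P :: "'a \<Rightarrow> 'a measure"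
    and X :: "nat \<Rightarrow> 'w \<Rightarrow> 'a" and f :: "nat \<Rightarrow> 'a \<Rightarrow> real"
    and n :: nat and c lam \<sigma>2 :: real
  assumes "standard_borel M"
    and "stationary_markov_chain \<Omega> M P \<pi> X"
    and "lam = kernel_lambda \<pi> P" and "lam < 1"
    and "n \<ge> 1" and "c > 0"
    and "\<And>i. i \<in> {1..n} \<Longrightarrow> f i \<in> borel_measurable M"
    and "\<And>i x. i \<in> {1..n} \<Longrightarrow> x \<in> space M \<Longrightarrow> \<bar>f i x\<bar> \<le> c"
    and "\<And>i. i \<in> {1..n} \<Longrightarrow> (\<integral>x. f i x \<partial>\<pi>) = 0"
    and "\<sigma>2 = (\<Sum>i=1..n. \<integral>x. (f i x)\<^sup>2 \<partial>\<pi>) / real n"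
  shows "(\<forall>t. 0 \<le> t \<and> t < (1 - lam) / (5 * c) \<longrightarrow>
           (\<integral>\<omega>. exp (t * (\<Sum>i=1..n. f i (X i \<omega>))) \<partial>\<Omega>) \<le> exp (real n * g t lam c \<sigma>2))
       \<and> (\<forall>\<epsilon>>0.
           ereal (measure \<Omega> {\<omega> \<in> space \<Omega>. (\<Sum>i=1..n. f i (X i \<omega>)) / real n \<ge> \<epsilon>})
             \<le> exp_ereal (- (ereal (real n) * gstar \<epsilon> lam c \<sigma>2))
         \<and> gstar \<epsilon> lam c \<sigma>2 \<ge> ereal ((\<epsilon>\<^sup>2 / 2) / (\<alpha>1 lam * \<sigma>2 + \<alpha>2 lam * c * \<epsilon>)))"
proof -
  interpret stationary_chain \<Omega> M \<pi> P X using assms(2) by unfold_locales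
  note lam = assms(3,4) and n = assms(5) and c = assms(6)
  have f: "f i \<in> borel_measurable \<pi>" if "i \<in> {1..n}" for i
    using assms(7)[OF that] by (simp only: measurable_cong_sets[OF sets_pi refl])
  have bound: "\<bar>f i x\<bar> \<le> c" if "i \<in> {1..n}" "x \<in> space \<pi>" for i x
    using assms(8) that by (simp add: space_pi)
  have lam0: "0 \<le> lam" by (simp add: lam(1) kernel_lambda_nonneg)
  have \<sigma>2: "0 \<le> \<sigma>2" unfolding assms(10) by (intro divide_nonneg_nonneg sum_nonneg) auto
  define S where "S = (\<lambda>\<omega>. \<Sum>i=1..n. f i (X i \<omega>))"
  \<comment> \<open>At lam = 0 this covers every t \<ge> 0, beyond the range claimed for the moment
    generating function, because the conjugate at lam = 0 ranges over all of them.\<close>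
  have mgf: "Om.expectation (\<lambda>\<omega>. exp (t * S \<omega>)) \<le> exp (real n * g t lam c \<sigma>2)"
    if "0 \<le> t" "lam \<noteq> 0 \<Longrightarrow> 5 * c * t < 1 - lam" for t
    unfolding S_def assms(10) by (rule expectation_exp_sum_le[OF lam(1) n c f bound assms(9) that])
  have S_bm: "S \<in> bounded_measurable \<Omega>"
  proof (rule bounded_measurableI)
    show "S \<in> borel_measurable \<Omega>"
      unfolding S_def using measurable_compose[OF X_measurable f] by (intro borel_measurable_sum) auto
    show "\<bar>S \<omega>\<bar> \<le> (\<Sum>i=1..n. c)" if "\<omega> \<in> space \<Omega>" for \<omega>
      unfolding S_def using measurable_space[OF X_measurable that]
      by (intro order.trans[OF sum_abs] sum_mono bound) auto
  qed
  have tail: "Om.prob {\<omega> \<in> space \<Omega>. S \<omega> / real n \<ge> \<epsilon>} \<le> exp (- (real n * (t * \<epsilon> - g t lam c \<sigma>2)))"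
    if t: "0 \<le> t" "lam \<noteq> 0 \<Longrightarrow> 5 * c * t < 1 - lam" for t \<epsilon>
  \<comment> \<open>Chernoff's inequality requires t > 0; at t = 0 the right side is 1.\<close>
  proof (cases "t = 0")
    case True
    then show ?thesis by (simp add: g_def)
  next
    case False
    have "integrable \<Omega> (\<lambda>\<omega>. exp (t * S \<omega>))"
      by (intro Om.integrable_bounded_measurable bounded_measurable_exp bounded_measurable_mult
          bounded_measurable_const S_bm)
    from integrable_mult_indicator[OF sets.top this]
    have "Om.prob {\<omega> \<in> space \<Omega>. S \<omega> \<ge> real n * \<epsilon>}
        \<le> exp (- t * (real n * \<epsilon>)) * (\<integral>\<omega>\<in>space \<Omega>. exp (t * S \<omega>) \<partial>\<Omega>)"
      using t False by (intro Om.Chernoff_ineq_ge) (simp_all add: set_integrable_def)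
    also have "(\<integral>\<omega>\<in>space \<Omega>. exp (t * S \<omega>) \<partial>\<Omega>) = Om.expectation (\<lambda>\<omega>. exp (t * S \<omega>))"
      unfolding set_lebesgue_integral_def by (intro Bochner_Integration.integral_cong) auto
    also have "exp (- t * (real n * \<epsilon>)) * \<dots> \<le> exp (- t * (real n * \<epsilon>)) * exp (real n * g t lam c \<sigma>2)"
      using mgf[OF t] by (intro mult_left_mono) auto
    also have "\<dots> = exp (- (real n * (t * \<epsilon> - g t lam c \<sigma>2)))"
      by (simp add: exp_add[symmetric] algebra_simps)
    also have "{\<omega> \<in> space \<Omega>. S \<omega> \<ge> real n * \<epsilon>} = {\<omega> \<in> space \<Omega>. S \<omega> / real n \<ge> \<epsilon>}"
      using n by (auto simp: field_simps)
    finally show ?thesis .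
  qed
  show ?thesis
  proof (intro conjI allI impI)
    fix t assume "0 \<le> t \<and> t < (1 - lam) / (5 * c)"
    then show "(\<integral>\<omega>. exp (t * (\<Sum>i=1..n. f i (X i \<omega>))) \<partial>\<Omega>) \<le> exp (real n * g t lam c \<sigma>2)"
      using mgf[of t] c by (simp add: S_def field_simps)
  next
    fix \<epsilon> :: real
    show "ereal (measure \<Omega> {\<omega> \<in> space \<Omega>. (\<Sum>i=1..n. f i (X i \<omega>)) / real n \<ge> \<epsilon>})
        \<le> exp_ereal (- (ereal (real n) * gstar \<epsilon> lam c \<sigma>2))"
      using tail n by (intro le_exp_gstar[OF _ c lam(2)]) (auto simp: S_def)
  next
    fix \<epsilon> :: real assume "0 < \<epsilon>"
    then show "gstar \<epsilon> lam c \<sigma>2 \<ge> ereal ((\<epsilon>\<^sup>2 / 2) / (\<alpha>1 lam * \<sigma>2 + \<alpha>2 lam * c * \<epsilon>))"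
      by (intro gstar_ge_bernstein \<sigma>2 c lam0 lam(2))
  qed
qed

end
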